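(* If there is a polynomial-time $f$-approximation algorithm for Densest $k$-Subhypergraph, then there is a polynomial-time $O(f\log p)$-approximation algorithm for Minimum $p$-Union.
   Context: A hypergraph $H=(V,E)$ has a finite vertex set $V$ and a collection $E$ of subsets of $V$ (hyperedges). Densest $k$-Subhypergraph: given $H$ and integer $k$, find $W\subseteq V$ with $|W|=k$ maximizing the number of hyperedges $e\subseteq W$; an $f$-approximation returns such a $W$ containing at least a $1/f$ fraction of the optimal number. Minimum $p$-Union: given $H$ and integer $p$, find $E'\subseteq E$ with $|E'|=p$ minimizing $|\bigcup_{e\in E'}e|$. *)

theory Defs
  imports Complex_Main "HOL-Computational_Algebra.Polynomial"
begin

section \<open>Hypergraphs and the two optimization problems\<close>

definition hypergraph :: "'a set \<Rightarrow> 'a set set \<Rightarrow> bool" where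
  "hypergraph V E \<longleftrightarrow> finite V \<and> E \<subseteq> Pow V"

definition edges_within :: "'a set set \<Rightarrow> 'a set \<Rightarrow> 'a set set" where
  "edges_within E W = {e \<in> E. e \<subseteq> W}"

text \<open>The maximum (minimum) below is over a finite set, which is nonempty exactly when
  \<open>k \<le> card V\<close> (\<open>p \<le> card E\<close>); see the lemmas that follow.\<close>

definition dksh_opt :: "'a set \<Rightarrow> 'a set set \<Rightarrow> nat \<Rightarrow> nat" where
  "dksh_opt V E k = Max {card (edges_within E W) | W. W \<subseteq> V \<and> card W = k}"

definition mpu_opt :: "'a set set \<Rightarrow> nat \<Rightarrow> nat" where
  "mpu_opt E p = Min {card (\<Union>E') | E'. E' \<subseteq> E \<and> card E' = p}"

definition dksh_approx :: "real \<Rightarrow> 'a set \<Rightarrow> 'a set set \<Rightarrow> nat \<Rightarrow> 'a set \<Rightarrow> bool" where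
  "dksh_approx r V E k W \<longleftrightarrow>
     W \<subseteq> V \<and> card W = k \<and>
     real (card (edges_within E W)) \<ge> (1 / r) * real (dksh_opt V E k)"

definition mpu_approx :: "real \<Rightarrow> 'a set set \<Rightarrow> nat \<Rightarrow> 'a set set \<Rightarrow> bool" where
  "mpu_approx r E p E' \<longleftrightarrow>
     E' \<subseteq> E \<and> card E' = p \<and>
     real (card (\<Union>E')) \<le> r * real (mpu_opt E p)"

lemma dksh_feasible:
  assumes "hypergraph V E"
  shows "finite {card (edges_within E W) | W. W \<subseteq> V \<and> card W = k}"
    and "{card (edges_within E W) | W. W \<subseteq> V \<and> card W = k} \<noteq> {} \<longleftrightarrow> k \<le> card V"
proof -
  have fin: "finite V" using assms by (simp add: hypergraph_def)
  have "{card (edges_within E W) | W. W \<subseteq> V \<and> card W = k}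
        \<subseteq> (\<lambda>W. card (edges_within E W)) ` Pow V" by auto
  then show "finite {card (edges_within E W) | W. W \<subseteq> V \<and> card W = k}"
    using fin by (meson finite_Pow_iff finite_imageI finite_subset)
  have "(\<exists>W \<subseteq> V. card W = k) \<longleftrightarrow> k \<le> card V"
    using fin card_mono obtain_subset_with_card_n by metis
  then show "{card (edges_within E W) | W. W \<subseteq> V \<and> card W = k} \<noteq> {} \<longleftrightarrow> k \<le> card V"
    by auto
qed

lemma mpu_feasible:
  assumes "hypergraph V E"
  shows "finite {card (\<Union>E') | E'. E' \<subseteq> E \<and> card E' = p}"
    and "{card (\<Union>E') | E'. E' \<subseteq> E \<and> card E' = p} \<noteq> {} \<longleftrightarrow> p \<le> card E"
proof -
  have fin: "finite E"
    using assms by (meson finite_Pow_iff finite_subset hypergraph_def)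
  have "{card (\<Union>E') | E'. E' \<subseteq> E \<and> card E' = p} \<subseteq> (\<lambda>E'. card (\<Union>E')) ` Pow E" by auto
  then show "finite {card (\<Union>E') | E'. E' \<subseteq> E \<and> card E' = p}"
    using fin by (meson finite_Pow_iff finite_imageI finite_subset)
  have "(\<exists>E' \<subseteq> E. card E' = p) \<longleftrightarrow> p \<le> card E"
    using fin card_mono obtain_subset_with_card_n by metis
  then show "{card (\<Union>E') | E'. E' \<subseteq> E \<and> card E' = p} \<noteq> {} \<longleftrightarrow> p \<le> card E"
    by auto
qed


section \<open>Programs and their running time\<close>

text \<open>
  The machine model is a deterministic multi-stack machine in structured form: registers hold
  stacks of bits, and every elementary step touches only the top of one stack.  A program
  mentions only finitely many registers.  It is equivalent to the multitape Turing machine up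
  to a constant factor in time: one tape per register simulates a program, and conversely a tape
  is represented by two stacks (the cells to the left and to the right of the head) while the
  control state and the tape symbols are coded by constantly many bits.
\<close>

type_synonym store = "nat \<Rightarrow> bool list"

datatype test = Nonempty nat | Top nat

fun holds :: "test \<Rightarrow> store \<Rightarrow> bool" where
  "holds (Nonempty r) s \<longleftrightarrow> s r \<noteq> []"
| "holds (Top r) s \<longleftrightarrow> s r \<noteq> [] \<and> hd (s r)"

datatype prog =
    Skip
  | Push nat bool
  | Pop nat
  | Seq prog prog
  | Cond test prog prog
  | While test prog

text \<open>\<open>exec c s t s'\<close>: started in \<open>s\<close>, the program \<open>c\<close> halts in \<open>s'\<close> after exactly \<open>t\<close> steps, where
  each elementary instruction and each evaluation of a test is one step.  Popping an empty stack
  has no effect.\<close>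

inductive exec :: "prog \<Rightarrow> store \<Rightarrow> nat \<Rightarrow> store \<Rightarrow> bool" where
  Skip: "exec Skip s 1 s"
| Push: "exec (Push r b) s 1 (s(r := b # s r))"
| Pop: "exec (Pop r) s 1 (s(r := tl (s r)))"
| Seq: "exec c1 s t1 s' \<Longrightarrow> exec c2 s' t2 s'' \<Longrightarrow> exec (Seq c1 c2) s (t1 + t2) s''"
| CondTrue: "holds b s \<Longrightarrow> exec c1 s t s' \<Longrightarrow> exec (Cond b c1 c2) s (1 + t) s'"
| CondFalse: "\<not> holds b s \<Longrightarrow> exec c2 s t s' \<Longrightarrow> exec (Cond b c1 c2) s (1 + t) s'"
| WhileFalse: "\<not> holds b s \<Longrightarrow> exec (While b c) s 1 s"
| WhileTrue: "holds b s \<Longrightarrow> exec c s t1 s' \<Longrightarrow> exec (While b c) s' t2 s'' \<Longrightarrow>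
    exec (While b c) s (1 + t1 + t2) s''"

inductive_cases exec_elims:
  "exec Skip s t s'" "exec (Push r b) s t s'" "exec (Pop r) s t s'"
  "exec (Seq c1 c2) s t s'" "exec (Cond b c1 c2) s t s'" "exec (While b c) s t s'"

lemma exec_deterministic:
  "exec c s t s' \<Longrightarrow> exec c s u s'' \<Longrightarrow> t = u \<and> s' = s''"
proof (induction arbitrary: u s'' rule: exec.induct)
  case (Seq c1 s t1 s' c2 t2 s1)
  from Seq.prems show ?case
    by (rule exec_elims(4)) (use Seq.IH in blast)
next
  case (CondTrue b s c1 t s' c2)
  from CondTrue.prems show ?case
    by (rule exec_elims(5)) (use CondTrue.IH CondTrue.hyps(1) in auto)
next
  case (CondFalse b s c2 t s' c1)
  from CondFalse.prems show ?case
    by (rule exec_elims(5)) (use CondFalse.IH CondFalse.hyps(1) in auto)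
next
  case (WhileFalse b s c)
  from WhileFalse.prems show ?case
    by (rule exec_elims(6)) (use WhileFalse.hyps in simp_all)
next
  case (WhileTrue b s c t1 s' t2 s1)
  from WhileTrue.prems show ?case
    by (rule exec_elims(6)) (use WhileTrue.IH WhileTrue.hyps(1) in fastforce)+
qed (auto elim: exec_elims)

definition initial_store :: "bool list \<Rightarrow> store" where
  "initial_store w = (\<lambda>r. if r = 0 then w else [])"

text \<open>\<open>I\<close> is the set of instances, \<open>enc\<close> their encoding as a bit string, and \<open>sol x w\<close> says that the
  bit string \<open>w\<close> is an acceptable answer for \<open>x\<close>.  Register \<open>0\<close> holds both input and output.\<close>

definition solves_in_poly_time ::
  "prog \<Rightarrow> 'i set \<Rightarrow> ('i \<Rightarrow> bool list) \<Rightarrow> ('i \<Rightarrow> bool list \<Rightarrow> bool) \<Rightarrow> bool" where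
  "solves_in_poly_time c I enc sol \<longleftrightarrow>
     (\<exists>q :: nat poly. \<forall>x\<in>I. \<exists>t s.
        exec c (initial_store (enc x)) t s \<and> t \<le> poly q (length (enc x)) \<and> sol x (s 0))"


section \<open>Approximation algorithms\<close>

text \<open>
  A hypergraph is presented to an algorithm with vertex set \<open>{..<n}\<close> and a repetition-free list
  \<open>es\<close> of its hyperedges, as the incidence matrix with one row of \<open>n\<close> bits per hyperedge.
  The numbers are in unary; since \<open>k \<le> n\<close> and \<open>p \<le> length es\<close>, the
  encoding has length polynomial in the numbers of vertices and hyperedges.
\<close>

type_synonym inst = "nat \<times> nat set list \<times> nat"

definition unary :: "nat \<Rightarrow> bool list" where
  "unary k = replicate k True @ [False]"

definition char_vec :: "'a list \<Rightarrow> 'a set \<Rightarrow> bool list" where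
  "char_vec xs S = map (\<lambda>x. x \<in> S) xs"

fun encode :: "inst \<Rightarrow> bool list" where
  "encode (n, es, k) =
     unary n @ unary (length es) @ unary k @ concat (map (char_vec [0..<n]) es)"

definition dksh_instances :: "inst set" where
  "dksh_instances =
     {(n, es, k). hypergraph {..<n} (set es) \<and> distinct es \<and> k \<le> n}"

definition mpu_instances :: "inst set" where
  "mpu_instances =
     {(n, es, p). hypergraph {..<n} (set es) \<and> distinct es \<and> p \<le> length es}"

text \<open>The ratio may depend on the hypergraph (for instance on the numbers of vertices and
  hyperedges), and for the union problem also on \<open>p\<close>.  Answers are characteristic vectors.\<close>

definition dksh_approx_algorithm :: "(nat set \<Rightarrow> nat set set \<Rightarrow> real) \<Rightarrow> prog \<Rightarrow> bool" where
  "dksh_approx_algorithm f A \<longleftrightarrow>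
     solves_in_poly_time A dksh_instances encode
       (\<lambda>(n, es, k) w. \<exists>W. w = char_vec [0..<n] W \<and>
          dksh_approx (f {..<n} (set es)) {..<n} (set es) k W)"

definition mpu_approx_algorithm :: "(nat set \<Rightarrow> nat set set \<Rightarrow> nat \<Rightarrow> real) \<Rightarrow> prog \<Rightarrow> bool" where
  "mpu_approx_algorithm g B \<longleftrightarrow>
     solves_in_poly_time B mpu_instances encode
       (\<lambda>(n, es, p) w. \<exists>E'. w = char_vec es E' \<and>
          mpu_approx (g {..<n} (set es) p) (set es) p E')"

text \<open>Admissible ratios are at least 1 and do not increase when hyperedges are deleted; the latter
  is automatic for constants and for functions of the number of vertices.\<close>

definition approx_ratio :: "('a set \<Rightarrow> 'a set set \<Rightarrow> real) \<Rightarrow> bool" where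
  "approx_ratio f \<longleftrightarrow>
     (\<forall>V E. hypergraph V E \<longrightarrow> 1 \<le> f V E) \<and>
     (\<forall>V E E'. hypergraph V E \<and> E' \<subseteq> E \<longrightarrow> f V E' \<le> f V E)"

end

theory Submission
  imports Defs
begin

text \<open>For every guess \<open>k\<close> of the optimal union size, repeatedly ask the given algorithm for a dense set
  of \<open>k\<close> vertices in the hypergraph of the hyperedges that have not been picked, and pick the
  hyperedges inside it until \<open>p\<close> are picked; each round adds at most \<open>k\<close> vertices to the union.
  If \<open>k\<close> is the optimum, the unpicked hyperedges of an optimal solution show that a round leaves
  at most a \<open>1 - 1/f\<close> fraction of the hyperedges still to be picked, so \<open>1 + f ln p\<close> rounds suffice.
  The number of rounds is not known to the algorithm, so it compares the guesses by \<open>k\<close> times the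
  number of rounds used and returns the cheapest.

  To obtain a program, the polynomial-time functions on encoded data are shown to be closed under
  composition, pairing, case distinction and folds with polynomially bounded intermediate results.
  The given program becomes a function in this calculus by clearing its registers after the run.\<close>

section \<open>Running programs inside larger stores\<close>

text \<open>The given algorithm promises nothing outside encoded instances; there it may even fail
  to halt. Hence every notion of polynomial time carries a domain \<open>D\<close>, and the rule for
  folds asks for the body only on states that the fold really reaches. An invariant of the greedy
  states then shows that each query is again an encoded instance. Iterating a polynomial-time
  function can also blow up intermediate results exponentially, so folds carry an explicit size
  bound. The queries keep the vertex set and delete hyperedges, which is where monotonicity of the
  ratio enters. A guess is judged by its charge, \<open>k\<close> per round, rather than by its
  union. The charge bounds the union for every guess, right or wrong, while the charge itself has to
  be estimated only for the guess equal to the optimum. With \<open>F\<close> the ratio of the full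
  hypergraph, that guess takes at most \<open>1 + F * ln p\<close> rounds if \<open>p\<close> is
  positive. Both summands are at most \<open>F * log 2 (max 2 p)\<close>, whence the constant 2; the
  maximum keeps the logarithm at least 1 for \<open>p\<close> equal to 0 or 1.\<close>

definition runs :: "prog \<Rightarrow> store \<Rightarrow> nat \<Rightarrow> store \<Rightarrow> bool" where
  "runs c s T s' \<longleftrightarrow> (\<exists>t\<le>T. exec c s t s')"

lemma runs_mono: "runs c s T s' \<Longrightarrow> T \<le> T' \<Longrightarrow> runs c s T' s'"
  unfolding runs_def by (meson le_trans)

lemma runs_Skip: "runs Skip s 1 s"
  unfolding runs_def using exec.Skip by blast

lemma runs_Push: "runs (Push r b) s 1 (s(r := b # s r))"
  unfolding runs_def using exec.Push by blast

lemma runs_Pop: "runs (Pop r) s 1 (s(r := tl (s r)))"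
  unfolding runs_def using exec.Pop by blast

lemma runs_Seq:
  assumes "runs c1 s T1 s'" "runs c2 s' T2 s''"
  shows "runs (Seq c1 c2) s (T1 + T2) s''"
  using assms unfolding runs_def by (meson add_mono exec.Seq)

lemma runs_Cond:
  assumes "holds b s \<Longrightarrow> runs c1 s T s'" "\<not> holds b s \<Longrightarrow> runs c2 s T s'"
  shows "runs (Cond b c1 c2) s (1 + T) s'"
  using assms unfolding runs_def
  by (cases "holds b s") (meson add_left_mono exec.CondTrue exec.CondFalse)+

lemma runs_WhileFalse: "\<not> holds b s \<Longrightarrow> runs (While b c) s 1 s"
  unfolding runs_def using exec.WhileFalse by blast

lemma runs_WhileTrue:
  assumes "holds b s" "runs c s T1 s'" "runs (While b c) s' T2 s''"
  shows "runs (While b c) s (1 + T1 + T2) s''"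
  using assms unfolding runs_def by (meson add_mono add_left_mono exec.WhileTrue)

lemmas runs_simple = runs_Skip runs_Push runs_Pop runs_Seq runs_Cond

lemma runs_eq: "runs c s T s' \<Longrightarrow> T \<le> T' \<Longrightarrow> s' = s'' \<Longrightarrow> runs c s T' s''"
  using runs_mono by blast

lemma exec_length: "exec c s t s' \<Longrightarrow> length (s' r) \<le> length (s r) + t"
  by (induction rule: exec.induct) auto

fun test_reg :: "test \<Rightarrow> nat" where
  "test_reg (Nonempty r) = r"
| "test_reg (Top r) = r"

primrec regs :: "prog \<Rightarrow> nat set" where
  "regs Skip = {}"
| "regs (Push r b) = {r}"
| "regs (Pop r) = {r}"
| "regs (Seq c1 c2) = regs c1 \<union> regs c2"
| "regs (Cond b c1 c2) = {test_reg b} \<union> regs c1 \<union> regs c2"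
| "regs (While b c) = {test_reg b} \<union> regs c"

lemma finite_regs: "finite (regs c)"
  by (induction c) auto

lemma regs_below: "\<exists>N>0. regs c \<subseteq> {..<N}"
  using finite_nat_iff_bounded[of "insert 0 (regs c)"] finite_regs[of c] by force

lemma holds_override_on: "test_reg b \<in> R \<Longrightarrow> holds b (override_on u s R) = holds b s"
  by (cases b) (auto simp: override_on_def)

text \<open>A run tests and changes only registers in \<open>regs c\<close>, so the contents outside
  \<open>R\<close> can be exchanged for those of \<open>u\<close> without affecting its course. This
  is what lets a program serve as a subroutine.\<close>

lemma exec_override_on:
  "exec c s t s' \<Longrightarrow> regs c \<subseteq> R \<Longrightarrow> exec c (override_on u s R) t (override_on u s' R)"
proof (induction rule: exec.induct)
  case (Push r b s)
  then have "override_on u (s(r := b # s r)) R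
      = (override_on u s R)(r := b # override_on u s R r)"
    by (auto simp: override_on_def)
  then show ?case by (metis exec.Push)
next
  case (Pop r s)
  then have "override_on u (s(r := tl (s r))) R
      = (override_on u s R)(r := tl (override_on u s R r))"
    by (auto simp: override_on_def)
  then show ?case by (metis exec.Pop)
next
  case (WhileTrue b s c t1 s' t2 s'')
  then show ?case
    using exec.WhileTrue[of b "override_on u s R" c t1 "override_on u s' R"]
    by (simp add: holds_override_on)
next
  case (Skip s)
  show ?case by (rule exec.Skip)
next
  case (CondTrue b s c1 t s' c2)
  then show ?case by (intro exec.CondTrue) (auto simp: holds_override_on)
next
  case (CondFalse b s c2 t s' c1)
  then show ?case by (intro exec.CondFalse) (auto simp: holds_override_on)
next
  case (WhileFalse b s c)
  then show ?case by (intro exec.WhileFalse) (auto simp: holds_override_on)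
qed (auto intro: exec.Seq)

lemma exec_outside: "exec c s t s' \<Longrightarrow> r \<notin> regs c \<Longrightarrow> s' r = s r"
  by (induction rule: exec.induct) auto

text \<open>For embedding a program that expects all other registers to be empty: the caller may
  keep data in the registers from \<open>N\<close> on while \<open>c\<close> runs.\<close>

lemma runs_frame:
  assumes "runs c (initial_store w) T (initial_store w')" "regs c \<subseteq> {..<N}" "0 < N"
    and "s 0 = w" "\<And>r. 0 < r \<Longrightarrow> r < N \<Longrightarrow> s r = []"
  shows "runs c s T (s(0 := w'))"
proof -
  have "override_on s (initial_store w) {..<N} = s"
    "override_on s (initial_store w') {..<N} = s(0 := w')"
    using assms(3-5) by (auto simp: override_on_def initial_store_def)
  then show ?thesis
    using assms(1,2) unfolding runs_def by (metis exec_override_on)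
qed


section \<open>Elementary loops\<close>

definition drain :: "nat \<Rightarrow> (bool \<Rightarrow> prog) \<Rightarrow> prog" where
  "drain r c =
     While (Nonempty r) (Cond (Top r) (Seq (Pop r) (c True)) (Seq (Pop r) (c False)))"

text \<open>\<open>F b\<close> is the effect of the body for the bit \<open>b\<close>. Commuting
  with updates of \<open>r\<close> expresses that the body neither reads nor writes the drained
  stack, so the effects can be folded over its original content. Each bit costs three steps beyond
  the body: loop test, branch test and pop.\<close>

lemma runs_drain:
  assumes step: "\<And>b (s :: store). runs (c b) s T (F b s)"
    and comm: "\<And>b (s :: store) v. F b (s(r := v)) = (F b s)(r := v)"
  shows "runs (drain r c) s (1 + length (s r) * (T + 3)) ((fold F (s r) s)(r := []))"
proof (induction "s r" arbitrary: s)
  case Nil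
  have "s(r := []) = s" using Nil by auto
  then show ?case
    using Nil[symmetric] runs_WhileFalse[of "Nonempty r" s] by (simp add: drain_def)
next
  case (Cons b xs)
  let ?s = "(F b s)(r := xs)"
  have fold_comm: "fold F ys (u(r := v)) = (fold F ys u)(r := v)" for ys u v
    by (induction ys arbitrary: u) (auto simp: comm)
  have "runs (Seq (Pop r) (c b)) s (1 + T) ?s"
    using runs_Seq[OF runs_Pop[of r s] step[of b]] Cons(2)[symmetric] by (simp add: comm)
  then have "runs (Cond (Top r) (Seq (Pop r) (c True)) (Seq (Pop r) (c False))) s
      (1 + (1 + T)) ?s"
    using Cons(2)[symmetric] by (intro runs_Cond) (cases b; simp)+
  moreover have "runs (drain r c) ?s (1 + length xs * (T + 3)) ((fold F xs ?s)(r := []))"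
    using Cons(1)[of ?s] by simp
  ultimately have "runs (drain r c) s (1 + (1 + (1 + T)) + (1 + length xs * (T + 3)))
      ((fold F xs ?s)(r := []))"
    unfolding drain_def by (rule runs_WhileTrue[rotated]) (simp flip: Cons(2))
  then show ?case
    by (rule runs_eq) (simp_all flip: Cons(2) add: fold_comm)
qed

text \<open>A marker \<open>True\<close> precedes every bit, so that a marker \<open>False\<close>
  can end the block and the block can be read off the front of a longer string.\<close>

definition dbl :: "bool list \<Rightarrow> bool list" where
  "dbl bs = concat (map (\<lambda>b. [True, b]) bs)"

lemma dbl_simps [simp]: "dbl [] = []" "dbl (b # bs) = True # b # dbl bs"
    "dbl (as @ bs) = dbl as @ dbl bs"
  by (simp_all add: dbl_def)

lemma length_dbl [simp]: "length (dbl bs) = 2 * length bs"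
  by (induction bs) auto

definition clear :: "nat \<Rightarrow> prog" where
  "clear r = drain r (\<lambda>_. Skip)"

lemma runs_clear: "runs (clear r) s (1 + length (s r) * 4) (s(r := []))"
proof -
  have "fold (\<lambda>_ u. u) bs s = s" for bs :: "bool list"
    by (induction bs) auto
  then show ?thesis
    using runs_drain[of "\<lambda>_. Skip" 1 "\<lambda>_ u. u" r s] runs_Skip by (simp add: clear_def)
qed

definition move :: "nat \<Rightarrow> nat \<Rightarrow> prog" where
  "move r q = drain r (Push q)"

lemma runs_move:
  assumes "r \<noteq> q"
  shows "runs (move r q) s (1 + length (s r) * 4) (s(r := [], q := rev (s r) @ s q))"
proof -
  have "fold (\<lambda>b u. u(q := b # u q)) bs s = s(q := rev bs @ s q)" for bs
    by (induction bs arbitrary: s) auto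
  then show ?thesis
    using runs_drain[of "Push q" 1 "\<lambda>b u. u(q := b # u q)" r s] runs_Push assms
    by (simp add: move_def fun_upd_twist)
qed

definition move2 :: "nat \<Rightarrow> nat \<Rightarrow> nat \<Rightarrow> prog" where
  "move2 r q q' = drain r (\<lambda>b. Seq (Push q b) (Push q' b))"

lemma runs_move2:
  assumes "r \<noteq> q" "r \<noteq> q'" "q \<noteq> q'"
  shows "runs (move2 r q q') s (1 + length (s r) * 5)
           (s(r := [], q := rev (s r) @ s q, q' := rev (s r) @ s q'))"
proof -
  let ?F = "\<lambda>b u. u(q := b # u q, q' := b # u q')"
  have "fold ?F bs s = s(q := rev bs @ s q, q' := rev bs @ s q')" for bs
    using assms(3) by (induction bs arbitrary: s) (auto simp: fun_eq_iff)
  moreover have "runs (Seq (Push q b) (Push q' b)) u 2 (?F b u)" for b u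
    by (rule runs_eq, (rule runs_simple)+) (use assms in auto)
  ultimately show ?thesis
    using runs_drain[of "\<lambda>b. Seq (Push q b) (Push q' b)" 2 ?F r s] assms
    by (simp add: move2_def fun_upd_twist)
qed

definition move_dbl :: "nat \<Rightarrow> nat \<Rightarrow> prog" where
  "move_dbl r q = drain r (\<lambda>b. Seq (Push q b) (Push q True))"

lemma runs_move_dbl:
  assumes "r \<noteq> q"
  shows "runs (move_dbl r q) s (1 + length (s r) * 5) (s(r := [], q := dbl (rev (s r)) @ s q))"
proof -
  let ?F = "\<lambda>b u. u(q := True # b # u q)"
  have "fold ?F bs s = s(q := dbl (rev bs) @ s q)" for bs
    by (induction bs arbitrary: s) auto
  moreover have "runs (Seq (Push q b) (Push q True)) u 2 (?F b u)" for b u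
    by (rule runs_eq, (rule runs_simple)+) auto
  ultimately show ?thesis
    using runs_drain[of "\<lambda>b. Seq (Push q b) (Push q True)" 2 ?F r s] assms
    by (simp add: move_dbl_def fun_upd_twist)
qed

definition unpair :: prog where
  "unpair = While (Top 0) (Seq (Pop 0) (Seq (Cond (Top 0) (Push 1 True) (Push 1 False)) (Pop 0)))"

lemma runs_unpair:
  assumes "s 0 = dbl as @ False # bs"
  shows "runs unpair s (1 + length as * 5) (s(0 := False # bs, 1 := rev as @ s 1))"
  using assms
proof (induction as arbitrary: s)
  case Nil
  then have eq: "s(0 := False # bs, 1 := rev [] @ s 1) = s" by auto
  have "runs unpair s 1 s"
    unfolding unpair_def by (rule runs_WhileFalse) (use Nil in simp)
  then show ?case by (rule runs_eq[OF _ _ eq[symmetric]]) simp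
next
  case (Cons a as)
  let ?s = "s(0 := dbl as @ False # bs, 1 := a # s 1)"
  let ?s1 = "s(0 := a # dbl as @ False # bs)"
  let ?s2 = "?s1(1 := a # ?s1 1)"
  have 1: "runs (Pop 0) s 1 ?s1"
    using runs_Pop[of 0 s] Cons.prems by simp
  have 2: "runs (Cond (Top 0) (Push 1 True) (Push 1 False)) ?s1 (1 + 1) ?s2"
    by (intro runs_Cond) (use runs_Push[of 1 a ?s1] in \<open>cases a; simp\<close>)+
  have 3: "runs (Pop 0) ?s2 1 ?s"
    by (rule runs_eq[OF runs_Pop]) (auto simp: fun_eq_iff)
  have 4: "runs unpair ?s (1 + length as * 5) (?s(0 := False # bs, 1 := rev as @ ?s 1))"
    by (rule Cons.IH) simp
  note runs_Seq[OF 1 runs_Seq[OF 2 3]]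
  then have "runs unpair s (1 + (1 + (1 + 1 + 1)) + (1 + length as * 5))
      (?s(0 := False # bs, 1 := rev as @ ?s 1))"
    unfolding unpair_def
    by (rule runs_WhileTrue[rotated, OF _ 4[unfolded unpair_def]]) (use Cons.prems in simp)
  then show ?case
    by (rule runs_eq) (auto simp: fun_eq_iff)
qed


section \<open>String functions computable in polynomial time\<close>

lemma poly_nat_mono: "m \<le> n \<Longrightarrow> poly q m \<le> poly q (n :: nat)"
  by (induction q) (auto intro!: add_mono mult_mono)

text \<open>The index \<open>x\<close> ranges over \<open>D\<close>, and \<open>i\<close>,
  \<open>j\<close> are two ways of writing down data attached to \<open>x\<close>. The final store
  has to be an \<open>initial_store\<close> again, so that a second program can be appended
  directly.\<close>

definition polyrun :: "'x set \<Rightarrow> ('x \<Rightarrow> bool list) \<Rightarrow> ('x \<Rightarrow> bool list) \<Rightarrow> bool" where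
  "polyrun D i j \<longleftrightarrow> (\<exists>c q. \<forall>x\<in>D.
     runs c (initial_store (i x)) (poly q (length (i x))) (initial_store (j x)))"

lemma polyrunI:
  assumes "\<And>x. x \<in> D \<Longrightarrow>
    runs c (initial_store (i x)) (poly q (length (i x))) (initial_store (j x))"
  shows "polyrun D i j"
  using assms unfolding polyrun_def by blast

lemma polyrunI_linear:
  assumes "\<And>x. x \<in> D \<Longrightarrow>
    runs c (initial_store (i x)) (a + b * length (i x)) (initial_store (j x))"
  shows "polyrun D i j"
  by (rule polyrunI[where q = "[:a, b:]"]) (use assms in \<open>simp add: mult.commute\<close>)

text \<open>A step pushes at most one bit, so the output is no longer than the input plus the
  running time. Composition uses this to bound the second running time in terms of the first
  input.\<close>

lemma polyrun_length:
  assumes "polyrun D i j"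
  shows "\<exists>q. \<forall>x\<in>D. length (j x) \<le> poly q (length (i x))"
proof -
  obtain c q where
    *: "\<And>x. x \<in> D \<Longrightarrow> runs c (initial_store (i x)) (poly q (length (i x))) (initial_store (j x))"
    using assms unfolding polyrun_def by blast
  have "length (j x) \<le> poly ([:0, 1:] + q) (length (i x))" if x: "x \<in> D" for x
  proof -
    obtain t where t: "t \<le> poly q (length (i x))"
      and e: "exec c (initial_store (i x)) t (initial_store (j x))"
      using *[OF x] unfolding runs_def by blast
    show ?thesis
      using exec_length[OF e, of 0] t by (simp add: initial_store_def)
  qed
  then show ?thesis by blast
qed

lemma polyrun_cong:
  assumes "polyrun D i j" "\<And>x. x \<in> D \<Longrightarrow> i x = i' x" "\<And>x. x \<in> D \<Longrightarrow> j x = j' x"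
  shows "polyrun D i' j'"
  using assms unfolding polyrun_def by metis

lemma polyrun_subst:
  assumes "polyrun D i j" "g ` D' \<subseteq> D"
  shows "polyrun D' (\<lambda>x. i (g x)) (\<lambda>x. j (g x))"
  using assms unfolding polyrun_def by (meson image_subset_iff)

lemma polyrun_refl: "polyrun D i i"
  by (rule polyrunI_linear[where c = Skip and a = 1 and b = 0]) (use runs_Skip in simp)

lemma polyrun_trans [trans]:
  assumes "polyrun D i j" "polyrun D j k"
  shows "polyrun D i k"
proof -
  obtain r where r: "\<And>x. x \<in> D \<Longrightarrow> length (j x) \<le> poly r (length (i x))"
    using polyrun_length[OF assms(1)] by blast
  obtain c q where
    c: "\<And>x. x \<in> D \<Longrightarrow> runs c (initial_store (i x)) (poly q (length (i x))) (initial_store (j x))"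
    using assms(1) unfolding polyrun_def by blast
  obtain c' q' where
    c': "\<And>x. x \<in> D \<Longrightarrow> runs c' (initial_store (j x)) (poly q' (length (j x))) (initial_store (k x))"
    using assms(2) unfolding polyrun_def by blast
  show ?thesis
  proof (rule polyrunI)
    fix x assume x: "x \<in> D"
    have "poly q' (length (j x)) \<le> poly q' (poly r (length (i x)))"
      by (rule poly_nat_mono) (rule r[OF x])
    then show "runs (Seq c c') (initial_store (i x)) (poly (q + pcompose q' r) (length (i x)))
        (initial_store (k x))"
      using runs_Seq[OF c[OF x] runs_mono[OF c'[OF x]]] by (simp add: poly_pcompose)
  qed
qed

lemma initial_store_upd [simp]: "(initial_store w)(0 := v) = initial_store v"
  by (auto simp: initial_store_def)

lemma initial_store_0 [simp]: "initial_store w 0 = w"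
  by (simp add: initial_store_def)

lemma polyrun_push: "polyrun D i (\<lambda>x. b # i x)"
  by (rule polyrunI_linear[where c = "Push 0 b" and a = 1 and b = 0])
    (rule runs_eq[OF runs_Push], simp_all)

lemma polyrun_pop: "polyrun D i (\<lambda>x. tl (i x))"
  by (rule polyrunI_linear[where c = "Pop 0" and a = 1 and b = 0])
    (rule runs_eq[OF runs_Pop], simp_all)

lemma polyrun_clear: "polyrun D i (\<lambda>x. [])"
  by (rule polyrunI_linear[where c = "clear 0" and a = 1 and b = 4])
    (rule runs_eq[OF runs_clear], simp_all)

lemma polyrun_const: "polyrun D i (\<lambda>x. w)"
proof (induction w)
  case (Cons b w)
  then show ?case using polyrun_push polyrun_trans by blast
qed (rule polyrun_clear)

lemma polyrun_fst: "polyrun D (\<lambda>x. dbl (i x) @ False # j x) i"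
proof (rule polyrunI_linear)
  fix x assume "x \<in> D"
  let ?w = "dbl (i x) @ False # j x"
  let ?s = "(initial_store ?w)(0 := False # j x, 1 := rev (i x))"
  have 1: "runs unpair (initial_store ?w) (1 + length (i x) * 5) ?s"
    using runs_unpair[of "initial_store ?w" "i x" "j x"] by (simp add: initial_store_def)
  have 2: "runs (clear 0) ?s (1 + length (False # j x) * 4) (?s(0 := []))"
    using runs_clear[of 0 ?s] by simp
  have "runs (move 1 0) (?s(0 := [])) (1 + length (rev (i x)) * 4) (initial_store (i x))"
    by (rule runs_eq[OF runs_move]) (auto simp: fun_eq_iff initial_store_def)
  from runs_Seq[OF 1 runs_Seq[OF 2 this]]
  show "runs (Seq unpair (Seq (clear 0) (move 1 0))) (initial_store ?w)
      (10 + 10 * length ?w) (initial_store (i x))"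
    by (rule runs_mono) simp
qed

lemma polyrun_snd: "polyrun D (\<lambda>x. dbl (i x) @ False # j x) j"
proof (rule polyrunI_linear)
  fix x assume "x \<in> D"
  let ?w = "dbl (i x) @ False # j x"
  let ?s = "(initial_store ?w)(0 := False # j x, 1 := rev (i x))"
  have 1: "runs unpair (initial_store ?w) (1 + length (i x) * 5) ?s"
    using runs_unpair[of "initial_store ?w" "i x" "j x"] by (simp add: initial_store_def)
  have 2: "runs (Pop 0) ?s 1 (?s(0 := j x))"
    using runs_Pop[of 0 ?s] by simp
  have "runs (clear 1) (?s(0 := j x)) (1 + length (rev (i x)) * 4) (initial_store (j x))"
    by (rule runs_eq[OF runs_clear]) (auto simp: fun_eq_iff initial_store_def)
  from runs_Seq[OF 1 runs_Seq[OF 2 this]]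
  show "runs (Seq unpair (Seq (Pop 0) (clear 1))) (initial_store ?w)
      (10 + 10 * length ?w) (initial_store (j x))"
    by (rule runs_mono) simp
qed

text \<open>Both programs must see the same input, so a copy is kept above their registers. The
  first output is parked there as well, since it has to be doubled on top of the second one.\<close>

lemma polyrun_pair:
  assumes "polyrun D i j" "polyrun D i k"
  shows "polyrun D i (\<lambda>x. dbl (j x) @ False # k x)"
proof -
  obtain r where r: "\<And>x. x \<in> D \<Longrightarrow> length (j x) \<le> poly r (length (i x))"
    using polyrun_length[OF assms(1)] by blast
  obtain c q where
    c: "\<And>x. x \<in> D \<Longrightarrow> runs c (initial_store (i x)) (poly q (length (i x))) (initial_store (j x))"
    using assms(1) unfolding polyrun_def by blast
  obtain c' q' where
    c': "\<And>x. x \<in> D \<Longrightarrow> runs c' (initial_store (i x)) (poly q' (length (i x))) (initial_store (k x))"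
    using assms(2) unfolding polyrun_def by blast
  \<comment> \<open>\<open>N\<close> exceeds every register of both programs; \<open>N\<close> and
    \<open>Suc N\<close> are free for the saved input and the parked output.\<close>
  obtain N where N: "0 < N" "regs (Seq c c') \<subseteq> {..<N}"
    using regs_below by blast
  let ?p = "Seq (move2 0 N (Suc N)) (Seq (move (Suc N) 0) (Seq c (Seq (move 0 (Suc N))
    (Seq (move N 0) (Seq c' (Seq (Push 0 False) (move_dbl (Suc N) 0)))))))"
  let ?q = "[:8, 13:] + q + smult 9 r + q'"
  show ?thesis
  proof (rule polyrunI[where c = ?p and q = ?q])
    fix x assume x: "x \<in> D"
    define s where "s a b d = (\<lambda>_ :: nat. [] :: bool list)(0 := a, N := b, Suc N := d)" for a b d
    have s: "s a b d 0 = a" "s a b d N = b" "s a b d (Suc N) = d"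
      "(s a b d)(0 := a') = s a' b d" for a a' b d
      using N(1) by (auto simp: s_def fun_eq_iff)
    have s0: "s a b d r = []" if "0 < r" "r < N" for a b d r
      using that by (simp add: s_def)
    have init: "initial_store a = s a [] []" for a
      using N(1) by (auto simp: s_def initial_store_def fun_eq_iff)
    have 1: "runs (move2 0 N (Suc N)) (s (i x) [] []) (1 + length (i x) * 5)
        (s [] (rev (i x)) (rev (i x)))"
      by (rule runs_eq[OF runs_move2]) (use N(1) in \<open>auto simp: s_def fun_eq_iff\<close>)
    have 2: "runs (move (Suc N) 0) (s [] (rev (i x)) (rev (i x))) (1 + length (i x) * 4)
        (s (i x) (rev (i x)) [])"
      by (rule runs_eq[OF runs_move]) (use N(1) in \<open>auto simp: s_def fun_eq_iff\<close>)
    have 3: "runs c (s (i x) (rev (i x)) []) (poly q (length (i x))) (s (j x) (rev (i x)) [])"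
      using runs_frame[OF c[OF x], of N "s (i x) (rev (i x)) []"] N by (simp add: s s0)
    have 4: "runs (move 0 (Suc N)) (s (j x) (rev (i x)) []) (1 + length (j x) * 4)
        (s [] (rev (i x)) (rev (j x)))"
      by (rule runs_eq[OF runs_move]) (use N(1) in \<open>auto simp: s_def fun_eq_iff\<close>)
    have 5: "runs (move N 0) (s [] (rev (i x)) (rev (j x))) (1 + length (i x) * 4)
        (s (i x) [] (rev (j x)))"
      by (rule runs_eq[OF runs_move]) (use N(1) in \<open>auto simp: s_def fun_eq_iff\<close>)
    have 6: "runs c' (s (i x) [] (rev (j x))) (poly q' (length (i x))) (s (k x) [] (rev (j x)))"
      using runs_frame[OF c'[OF x], of N "s (i x) [] (rev (j x))"] N by (simp add: s s0)
    have 7: "runs (Push 0 False) (s (k x) [] (rev (j x))) 1 (s (False # k x) [] (rev (j x)))"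
      using runs_Push[of 0 False "s (k x) [] (rev (j x))"] by (simp add: s)
    have 8: "runs (move_dbl (Suc N) 0) (s (False # k x) [] (rev (j x))) (1 + length (j x) * 5)
        (s (dbl (j x) @ False # k x) [] [])"
      by (rule runs_eq[OF runs_move_dbl]) (use N(1) in \<open>auto simp: s_def fun_eq_iff\<close>)
    from runs_Seq[OF 1 runs_Seq[OF 2 runs_Seq[OF 3 runs_Seq[OF 4 runs_Seq[OF 5
      runs_Seq[OF 6 runs_Seq[OF 7 8]]]]]]]
    show "runs ?p (initial_store (i x)) (poly ?q (length (i x)))
        (initial_store (dbl (j x) @ False # k x))"
      unfolding init
      by (rule runs_mono) (use r[OF x] in simp)
  qed
qed

lemma polyrun_cond:
  assumes "polyrun {x \<in> D. b x} i j" "polyrun {x \<in> D. \<not> b x} i j"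
  shows "polyrun D (\<lambda>x. b x # i x) j"
proof -
  obtain c q where
    c: "\<And>x. x \<in> D \<Longrightarrow> b x \<Longrightarrow>
      runs c (initial_store (i x)) (poly q (length (i x))) (initial_store (j x))"
    using assms(1) unfolding polyrun_def by blast
  obtain c' q' where
    c': "\<And>x. x \<in> D \<Longrightarrow> \<not> b x \<Longrightarrow>
      runs c' (initial_store (i x)) (poly q' (length (i x))) (initial_store (j x))"
    using assms(2) unfolding polyrun_def by blast
  let ?p = "Cond (Top 0) (Seq (Pop 0) c) (Seq (Pop 0) c')"
  show ?thesis
  proof (rule polyrunI[where c = ?p and q = "[:2:] + q + q'"])
    fix x assume x: "x \<in> D"
    let ?w = "b x # i x"
    have pop: "runs (Pop 0) (initial_store ?w) 1 (initial_store (i x))"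
      using runs_Pop[of 0 "initial_store ?w"] by simp
    have "runs ?p (initial_store ?w)
        (1 + (1 + (poly q (length (i x)) + poly q' (length (i x))))) (initial_store (j x))"
      by (rule runs_Cond; rule runs_mono, rule runs_Seq[OF pop], rule c[OF x] c'[OF x])
        (auto simp: initial_store_def)
    moreover have "poly q (length (i x)) + poly q' (length (i x))
        \<le> poly q (length ?w) + poly q' (length ?w)"
      by (intro add_mono poly_nat_mono) auto
    ultimately show "runs ?p (initial_store ?w) (poly ([:2:] + q + q') (length ?w))
        (initial_store (j x))"
      by (elim runs_mono) simp
  qed
qed

lemma polyrun_cond_nonempty:
  assumes "polyrun {x \<in> D. i x \<noteq> []} i j" "polyrun {x \<in> D. i x = []} i j"
  shows "polyrun D i j"
proof -
  obtain c q where
    c: "\<And>x. x \<in> D \<Longrightarrow> i x \<noteq> [] \<Longrightarrow>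
      runs c (initial_store (i x)) (poly q (length (i x))) (initial_store (j x))"
    using assms(1) unfolding polyrun_def by blast
  obtain c' q' where
    c': "\<And>x. x \<in> D \<Longrightarrow> i x = [] \<Longrightarrow>
      runs c' (initial_store (i x)) (poly q' (length (i x))) (initial_store (j x))"
    using assms(2) unfolding polyrun_def by blast
  show ?thesis
  proof (rule polyrunI[where c = "Cond (Nonempty 0) c c'" and q = "[:1:] + q + q'"])
    fix x assume x: "x \<in> D"
    have "runs (Cond (Nonempty 0) c c') (initial_store (i x))
        (1 + (poly q (length (i x)) + poly q' (length (i x)))) (initial_store (j x))"
      by (rule runs_Cond; rule runs_mono, rule c[OF x] c'[OF x]) auto
    then show "runs (Cond (Nonempty 0) c c') (initial_store (i x))
        (poly ([:1:] + q + q') (length (i x))) (initial_store (j x))"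
      by (rule runs_mono) simp
  qed
qed

text \<open>\<open>next\<close> acts on abstract states, \<open>e\<close> writes them down, and the
  top bit decides about continuing. The size bound \<open>r\<close> is a separate premise because
  iterating a body of polynomial growth could otherwise produce exponentially long states.\<close>

lemma polyrun_while:
  fixes e :: "'z \<Rightarrow> bool list" and z :: "'x \<Rightarrow> 'z"
  assumes body: "polyrun S e (\<lambda>u. e (next u))"
    and S: "\<And>x j. x \<in> D \<Longrightarrow> j < k x \<Longrightarrow> (next ^^ j) (z x) \<in> S"
    and continue: "\<And>u. u \<in> S \<Longrightarrow> e u \<noteq> [] \<and> hd (e u)"
    and stop: "\<And>x. x \<in> D \<Longrightarrow> \<not> (e ((next ^^ k x) (z x)) \<noteq> [] \<and> hd (e ((next ^^ k x) (z x))))"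
    and k: "\<And>x. x \<in> D \<Longrightarrow> k x \<le> poly p (length (e (z x)))"
    and size: "\<And>x j. x \<in> D \<Longrightarrow> j < k x \<Longrightarrow>
      length (e ((next ^^ j) (z x))) \<le> poly r (length (e (z x)))"
  shows "polyrun D (\<lambda>x. e (z x)) (\<lambda>x. e ((next ^^ k x) (z x)))"
proof -
  obtain c q where
    c: "\<And>u. u \<in> S \<Longrightarrow> runs c (initial_store (e u)) (poly q (length (e u))) (initial_store (e (next u)))"
    using body unfolding polyrun_def by blast
  let ?q = "[:1:] + p * ([:1:] + pcompose q r)"
  show ?thesis
  proof (rule polyrunI[where c = "While (Top 0) c" and q = ?q])
    fix x assume x: "x \<in> D"
    define B where "B = 1 + poly q (poly r (length (e (z x))))"
    \<comment> \<open>Induction on the number \<open>d\<close> of rounds still to come, each costing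
      at most \<open>B\<close>.\<close>
    have "runs (While (Top 0) c) (initial_store (e ((next ^^ (k x - d)) (z x)))) (1 + d * B)
        (initial_store (e ((next ^^ k x) (z x))))" if "d \<le> k x" for d
      using that
    proof (induction d)
      case 0
      then show ?case
        using runs_WhileFalse[of "Top 0"] stop[OF x] by simp
    next
      case (Suc d)
      let ?u = "(next ^^ (k x - Suc d)) (z x)"
      have u: "?u \<in> S" using S[OF x, of "k x - Suc d"] Suc.prems by simp
      have "k x - d = Suc (k x - Suc d)" using Suc.prems by simp
      then have nxt: "(next ^^ (k x - d)) (z x) = next ?u" by simp
      have "length (e ?u) \<le> poly r (length (e (z x)))"
        using size[OF x, of "k x - Suc d"] Suc.prems by simp
      then have "poly q (length (e ?u)) \<le> poly q (poly r (length (e (z x))))"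
        by (rule poly_nat_mono)
      then have "1 + poly q (length (e ?u)) + (1 + d * B) \<le> 1 + Suc d * B"
        by (simp add: B_def)
      moreover have "holds (Top 0) (initial_store (e ?u))"
        using continue[OF u] by simp
      moreover have "runs (While (Top 0) c) (initial_store (e (next ?u))) (1 + d * B)
          (initial_store (e ((next ^^ k x) (z x))))"
        using Suc by (simp only: flip: nxt)
      ultimately show ?case
        by (intro runs_mono[OF runs_WhileTrue[OF _ c[OF u]]])
    qed
    from this[of "k x"]
    have "runs (While (Top 0) c) (initial_store (e (z x))) (1 + k x * B)
        (initial_store (e ((next ^^ k x) (z x))))"
      by simp
    moreover have "1 + k x * B \<le> poly ?q (length (e (z x)))"
      using k[OF x] by (simp add: B_def poly_pcompose add_mono mult_mono)
    ultimately show "runs (While (Top 0) c) (initial_store (e (z x))) (poly ?q (length (e (z x))))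
        (initial_store (e ((next ^^ k x) (z x))))"
      by (rule runs_mono)
  qed
qed

section \<open>Polynomial-time functions on encoded data\<close>

text \<open>The first component of a pair is made self-delimiting by doubling, so that a nonempty list
  is encoded exactly like the pair of its head and its tail.\<close>

class encodable =
  fixes enc :: "'a \<Rightarrow> bool list"

instantiation bool :: encodable
begin
definition "enc b = [b]"
instance ..
end

instantiation prod :: (encodable, encodable) encodable
begin
definition "enc p = dbl (enc (fst p)) @ False # enc (snd p)"
instance ..
end

instantiation list :: (encodable) encodable
begin
primrec enc_list :: "'a list \<Rightarrow> bool list" where
  "enc_list [] = []"
| "enc_list (x # xs) = dbl (enc x) @ False # enc_list xs"
instance ..
end

abbreviation len :: "'a :: encodable \<Rightarrow> nat" where
  "len x \<equiv> length (enc x)"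

lemma enc_Pair: "enc (x, y) = dbl (enc x) @ False # enc y"
  by (simp add: enc_prod_def)

lemma enc_bool: "enc b = [b]"
  by (simp add: enc_bool_def)

lemma len_bool [simp]: "len (b :: bool) = 1"
  by (simp add: enc_bool_def)

lemma len_Pair [simp]: "len (x, y) = 2 * len x + 1 + len y"
  by (simp add: enc_prod_def)

lemma enc_Cons: "enc (x # xs) = enc (x, xs)"
  by (simp add: enc_Pair)

lemma enc_eq_Nil_iff [simp]: "enc (xs :: 'a :: encodable list) = [] \<longleftrightarrow> xs = []"
  by (cases xs) auto

lemma len_append: "len (xs @ ys) = len xs + len ys"
  by (induction xs) auto

lemma len_rev: "len (rev xs) = len xs"
  by (induction xs) (auto simp: len_append)

lemma len_elem: "x \<in> set xs \<Longrightarrow> len x \<le> len xs"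
  by (induction xs) auto

lemma length_le_len: "length xs \<le> len xs"
  by (induction xs) auto

lemma len_list_le: "(\<And>x. x \<in> set xs \<Longrightarrow> len x \<le> B) \<Longrightarrow> len xs \<le> length xs * (2 * B + 1)"
proof (induction xs)
  case (Cons x xs)
  then have "len x \<le> B" "len xs \<le> length xs * (2 * B + 1)" by auto
  then show ?case by simp
qed simp

lemma len_drop: "len (drop n xs) \<le> len xs"
  by (metis append_take_drop_id le_add2 len_append)

definition ptime :: "'a :: encodable set \<Rightarrow> ('a \<Rightarrow> 'b :: encodable) \<Rightarrow> bool" where
  "ptime D f \<longleftrightarrow> polyrun D enc (\<lambda>x. enc (f x))"

definition polybound :: "'a :: encodable set \<Rightarrow> ('a \<Rightarrow> nat) \<Rightarrow> bool" where
  "polybound D g \<longleftrightarrow> (\<exists>q. \<forall>x\<in>D. g x \<le> poly q (len x))"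

named_theorems ptime_intros
named_theorems polybound_intros

lemma polybound_const [polybound_intros]: "polybound D (\<lambda>x. c)"
  unfolding polybound_def by (rule exI[of _ "[:c:]"]) simp

lemma polybound_add [polybound_intros]:
  assumes "polybound D g" "polybound D h"
  shows "polybound D (\<lambda>x. g x + h x)"
proof -
  from assms obtain q r where "\<forall>x\<in>D. g x \<le> poly q (len x)" "\<forall>x\<in>D. h x \<le> poly r (len x)"
    unfolding polybound_def by blast
  then have "\<forall>x\<in>D. g x + h x \<le> poly (q + r) (len x)"
    by (simp add: add_mono)
  then show ?thesis unfolding polybound_def by blast
qed

lemma polybound_mult [polybound_intros]:
  assumes "polybound D g" "polybound D h"
  shows "polybound D (\<lambda>x. g x * h x)"
proof -
  from assms obtain q r where "\<forall>x\<in>D. g x \<le> poly q (len x)" "\<forall>x\<in>D. h x \<le> poly r (len x)"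
    unfolding polybound_def by blast
  then have "\<forall>x\<in>D. g x * h x \<le> poly (q * r) (len x)"
    by (simp add: mult_mono)
  then show ?thesis unfolding polybound_def by blast
qed

lemma polybound_poly:
  assumes "polybound D g"
  shows "polybound D (\<lambda>x. poly q (g x))"
proof -
  from assms obtain r where "\<forall>x\<in>D. g x \<le> poly r (len x)"
    unfolding polybound_def by blast
  then have "\<forall>x\<in>D. poly q (g x) \<le> poly (pcompose q r) (len x)"
    by (simp add: poly_nat_mono poly_pcompose)
  then show ?thesis unfolding polybound_def by blast
qed

lemma polybound_len: "ptime D f \<Longrightarrow> polybound D (\<lambda>x. len (f x))"
  unfolding ptime_def polybound_def by (rule polyrun_length)

lemma ptime_mono: "ptime D f \<Longrightarrow> D' \<subseteq> D \<Longrightarrow> ptime D' f"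
  unfolding ptime_def polyrun_def by (meson subsetD)

lemma ptime_cong: "ptime D f \<Longrightarrow> (\<And>x. x \<in> D \<Longrightarrow> f x = g x) \<Longrightarrow> ptime D g"
  unfolding ptime_def by (erule polyrun_cong) simp_all

lemma ptime_id [ptime_intros]: "ptime D (\<lambda>x. x)"
  unfolding ptime_def by (rule polyrun_refl)

lemma ptime_const [ptime_intros]: "ptime D (\<lambda>x. c)"
  unfolding ptime_def by (rule polyrun_const)

lemma ptime_comp:
  assumes "ptime D' h" "ptime D f" "\<And>x. x \<in> D \<Longrightarrow> f x \<in> D'"
  shows "ptime D (\<lambda>x. h (f x))"
  unfolding ptime_def
  by (rule polyrun_trans[OF assms(2)[unfolded ptime_def]],
      rule polyrun_subst[OF assms(1)[unfolded ptime_def]]) (use assms(3) in blast)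

text \<open>The form in which premises about uncurried bodies are applied: \<open>f\<close>
  rearranges a tuple, and \<open>g\<close> is the function as it occurs in the goal.\<close>

lemma ptime_comp_eq:
  assumes "ptime D' h" "ptime D f" "\<And>x. x \<in> D \<Longrightarrow> f x \<in> D' \<and> h (f x) = g x"
  shows "ptime D g"
  by (rule ptime_cong[OF ptime_comp[OF assms(1,2)]]) (use assms(3) in auto)

lemma ptime_Pair [ptime_intros]: "ptime D f \<Longrightarrow> ptime D g \<Longrightarrow> ptime D (\<lambda>x. (f x, g x))"
  unfolding ptime_def enc_Pair by (rule polyrun_pair)

lemma ptime_fst [ptime_intros]: "ptime D f \<Longrightarrow> ptime D (\<lambda>x. fst (f x))"
  unfolding ptime_def enc_prod_def by (erule polyrun_trans) (rule polyrun_fst)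

lemma ptime_snd [ptime_intros]: "ptime D f \<Longrightarrow> ptime D (\<lambda>x. snd (f x))"
  unfolding ptime_def enc_prod_def by (erule polyrun_trans) (rule polyrun_snd)

lemma ptime_Cons [ptime_intros]: "ptime D f \<Longrightarrow> ptime D g \<Longrightarrow> ptime D (\<lambda>x. f x # g x)"
  using ptime_Pair[of D f g] unfolding ptime_def enc_Cons .

text \<open>Each branch is considered only on the part of \<open>D\<close> where it is taken, so
  partial operations such as \<open>hd\<close> are available under their guard.\<close>

lemma ptime_if [ptime_intros]:
  assumes "ptime D b" "ptime {x \<in> D. b x} f" "ptime {x \<in> D. \<not> b x} g"
  shows "ptime D (\<lambda>x. if b x then f x else g x)"
proof -
  have "polyrun D enc (\<lambda>x. enc (b x, x))"
    using ptime_Pair[OF assms(1) ptime_id] unfolding ptime_def .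
  \<comment> \<open>The pair starts with the marker of \<open>b x\<close>. Removing it brings
    \<open>b x\<close> to the top, and \<open>x\<close> survives below for the branch.\<close>
  also have "polyrun D (\<lambda>x. enc (b x, x)) (\<lambda>x. b x # False # enc x)"
    by (rule polyrun_cong[OF polyrun_pop]) (auto simp: enc_Pair enc_bool)
  also have "polyrun D \<dots> (\<lambda>x. enc (if b x then f x else g x))"
  proof (rule polyrun_cond)
    have pop: "polyrun S (\<lambda>x. False # enc x) enc" for S :: "'a set"
      by (rule polyrun_cong[OF polyrun_pop]) auto
    show "polyrun {x \<in> D. b x} (\<lambda>x. False # enc x) (\<lambda>x. enc (if b x then f x else g x))"
      by (rule polyrun_trans[OF pop], rule polyrun_cong[OF assms(2)[unfolded ptime_def]]) auto
    show "polyrun {x \<in> D. \<not> b x} (\<lambda>x. False # enc x) (\<lambda>x. enc (if b x then f x else g x))"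
      by (rule polyrun_trans[OF pop], rule polyrun_cong[OF assms(3)[unfolded ptime_def]]) auto
  qed
  finally show ?thesis unfolding ptime_def .
qed

lemma ptime_not [ptime_intros]:
  assumes "ptime D b"
  shows "ptime D (\<lambda>x. \<not> b x)"
  by (rule ptime_cong[where f = "\<lambda>x. if b x then False else True"])
    (intro ptime_if assms ptime_const, simp)

lemma ptime_conj [ptime_intros]:
  assumes "ptime D b" "ptime {x \<in> D. b x} c"
  shows "ptime D (\<lambda>x. b x \<and> c x)"
  by (rule ptime_cong[where f = "\<lambda>x. if b x then c x else False"])
    (intro ptime_if assms ptime_const, simp)

lemma ptime_null [ptime_intros]:
  fixes f :: "'a :: encodable \<Rightarrow> 'b :: encodable list"
  assumes "ptime D f"
  shows "ptime D (\<lambda>x. f x = [])"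
  unfolding ptime_def
proof (rule polyrun_trans[OF assms[unfolded ptime_def]], rule polyrun_cond_nonempty)
  show "polyrun {x \<in> D. enc (f x) \<noteq> []} (\<lambda>x. enc (f x)) (\<lambda>x. enc (f x = []))"
    by (rule polyrun_cong[OF polyrun_const[where w = "[False]"]]) (auto simp: enc_bool)
  show "polyrun {x \<in> D. enc (f x) = []} (\<lambda>x. enc (f x)) (\<lambda>x. enc (f x = []))"
    by (rule polyrun_cong[OF polyrun_const[where w = "[True]"]]) (auto simp: enc_bool)
qed

text \<open>A nonempty list is encoded like a pair, so its head is a first projection.\<close>

lemma ptime_hd:
  assumes "ptime D f" "\<And>x. x \<in> D \<Longrightarrow> f x \<noteq> []"
  shows "ptime D (\<lambda>x. hd (f x))"
  unfolding ptime_def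
proof (rule polyrun_trans[OF assms(1)[unfolded ptime_def]])
  show "polyrun D (\<lambda>x. enc (f x)) (\<lambda>x. enc (hd (f x)))"
  proof (rule polyrun_cong[OF polyrun_fst])
    show "dbl (enc (hd (f x))) @ False # enc (tl (f x)) = enc (f x)" if "x \<in> D" for x
      using assms(2)[OF that] by (cases "f x") auto
  qed simp
qed

lemma ptime_tl [ptime_intros]:
  assumes "ptime D f"
  shows "ptime D (\<lambda>x. tl (f x))"
  unfolding ptime_def
proof (rule polyrun_trans[OF assms[unfolded ptime_def]], rule polyrun_cond_nonempty)
  show "polyrun {x \<in> D. enc (f x) \<noteq> []} (\<lambda>x. enc (f x)) (\<lambda>x. enc (tl (f x)))"
  proof (rule polyrun_cong[OF polyrun_snd])
    show "dbl (enc (hd (f x))) @ False # enc (tl (f x)) = enc (f x)"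
      if "x \<in> {x \<in> D. enc (f x) \<noteq> []}" for x
      using that by (cases "f x") auto
  qed simp
  show "polyrun {x \<in> D. enc (f x) = []} (\<lambda>x. enc (f x)) (\<lambda>x. enc (tl (f x)))"
    by (rule polyrun_cong[OF polyrun_refl]) auto
qed

text \<open>The only loop: the encoding of \<open>(ys, acc, x)\<close> starts with \<open>True\<close> iff the remaining list
  \<open>ys\<close> is nonempty.\<close>

lemma ptime_foldl:
  assumes l: "ptime D l" and i: "ptime D i"
    and f: "ptime {(x, acc, y). x \<in> D \<and>
      (\<exists>pre suf. l x = pre @ y # suf \<and> acc = foldl (f x) (i x) pre)} (\<lambda>z. f (fst z) (fst (snd z)) (snd (snd z)))"
    and B: "polybound D B"
    and size: "\<And>x pre suf. x \<in> D \<Longrightarrow> l x = pre @ suf \<Longrightarrow> len (foldl (f x) (i x) pre) \<le> B x"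
  shows "ptime D (\<lambda>x. foldl (f x) (i x) (l x))"
proof -
  \<comment> \<open>The states from which another iteration is made. \<open>acc\<close> is tied to
    the consumed prefix so that the premise on the body applies.\<close>
  define S where "S = {(ys, acc, x). x \<in> D \<and> ys \<noteq> [] \<and>
    (\<exists>pre. l x = pre @ ys \<and> acc = foldl (f x) (i x) pre)}"
  define step where "step = (\<lambda>(ys, acc, x). (tl ys, f x acc (hd ys), x))"
  define z where "z x = (l x, i x, x)" for x
  obtain q where q: "\<And>x. x \<in> D \<Longrightarrow> B x \<le> poly q (len x)"
    using B unfolding polybound_def by blast
  have funpow: "(step ^^ j) (z x) = (drop j (l x), foldl (f x) (i x) (take j (l x)), x)"
    if "j \<le> length (l x)" for x j
    using that
  proof (induction j)
    case (Suc j)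
    then show ?case
      by (simp add: step_def take_Suc_conv_app_nth hd_drop_conv_nth tl_drop drop_Suc)
  qed (simp add: z_def)
  have "ptime S step"
  proof -
    let ?g = "\<lambda>u. f (snd (snd u)) (fst (snd u)) (hd (fst u))"
    have "ptime S (\<lambda>u. (snd (snd u), fst (snd u), hd (fst u)))"
      by (intro ptime_intros ptime_hd) (auto simp: S_def)
    then have "ptime S ?g"
      by (rule ptime_comp_eq[OF f]) (auto simp: S_def neq_Nil_conv, metis)
    then have "ptime S (\<lambda>u. (tl (fst u), ?g u, snd (snd u)))"
      by (intro ptime_intros)
    then show ?thesis
      by (rule ptime_cong) (auto simp: step_def)
  qed
  then have "polyrun S enc (\<lambda>u. enc (step u))"
    unfolding ptime_def .
  then have loop: "polyrun D (\<lambda>x. enc (z x)) (\<lambda>x. enc ((step ^^ length (l x)) (z x)))"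
  \<comment> \<open>In \<open>r\<close>, the linear part covers the unchanged \<open>x\<close> and
    the shrinking list, and the factor 2 accounts for the doubled encoding of the
    accumulator.\<close>
  proof (rule polyrun_while[where p = "[:0, 1:]" and r = "[:0, 1:] + smult 2 q"])
    fix x j assume x: "x \<in> D" "j < length (l x)"
    then show "(step ^^ j) (z x) \<in> S"
      by (auto simp: funpow S_def intro!: exI[of _ "take j (l x)"])
    have "len (foldl (f x) (i x) (take j (l x))) \<le> poly q (len x)"
      using size[OF x(1), of "take j (l x)" "drop j (l x)"] q[OF x(1)] by simp
    also have "\<dots> \<le> poly q (len (z x))"
      by (rule poly_nat_mono) (simp add: z_def)
    finally show "len ((step ^^ j) (z x)) \<le> poly ([:0, 1:] + smult 2 q) (len (z x))"
      using x len_drop[of j "l x"] by (simp add: funpow) (simp add: z_def)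
  next
    fix u assume "u \<in> S"
    then have "enc (fst u) \<noteq> []"
      by (auto simp: S_def)
    then show "enc u \<noteq> [] \<and> hd (enc u)"
      by (cases "enc (fst u)") (simp_all add: enc_prod_def)
  next
    fix x assume "x \<in> D"
    show "\<not> (enc ((step ^^ length (l x)) (z x)) \<noteq> [] \<and> hd (enc ((step ^^ length (l x)) (z x))))"
      by (simp add: funpow enc_Pair)
    show "length (l x) \<le> poly [:0, 1:] (len (z x))"
      using length_le_len[of "l x"] by (simp add: z_def)
  qed
  have "polyrun D enc (\<lambda>x. enc (z x))"
    using ptime_Pair[OF l ptime_Pair[OF i ptime_id]] unfolding ptime_def z_def .
  note this[THEN polyrun_trans, OF loop]
  then have "ptime D (\<lambda>x. (step ^^ length (l x)) (z x))"
    unfolding ptime_def .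
  then have "ptime D (\<lambda>x. fst (snd ((step ^^ length (l x)) (z x))))"
    by (intro ptime_fst ptime_snd)
  then show ?thesis
    by (rule ptime_cong) (simp add: funpow)
qed

section \<open>List functions computable in polynomial time\<close>

lemma ptime_rev [ptime_intros]:
  assumes "ptime D f"
  shows "ptime D (\<lambda>x. rev (f x))"
proof -
  have foldl: "foldl (\<lambda>acc y. y # acc) as xs = rev xs @ as" for as xs :: "'b list"
    by (induction xs arbitrary: as) auto
  have "ptime D (\<lambda>x. foldl (\<lambda>acc y. y # acc) [] (f x))"
    by (rule ptime_foldl[where B = "\<lambda>x. len (f x)"])
      (intro assms ptime_intros polybound_len | simp add: foldl len_rev len_append)+
  then show ?thesis by (simp add: foldl)
qed

text \<open>A right fold is a left fold over the reversed list, so suffixes take the role of the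
  consumed prefixes.\<close>

lemma ptime_foldr:
  assumes l: "ptime D l" and i: "ptime D i"
    and f: "ptime {(x, y, acc). x \<in> D \<and>
      (\<exists>pre suf. l x = pre @ y # suf \<and> acc = foldr (f x) suf (i x))} (\<lambda>z. f (fst z) (fst (snd z)) (snd (snd z)))"
    and B: "polybound D B"
    and size: "\<And>x pre suf. x \<in> D \<Longrightarrow> l x = pre @ suf \<Longrightarrow> len (foldr (f x) suf (i x)) \<le> B x"
  shows "ptime D (\<lambda>x. foldr (f x) (l x) (i x))"
  unfolding foldr_conv_foldl
proof (rule ptime_foldl[OF ptime_rev[OF l] i _ B])
  let ?S = "{(x, acc, y). x \<in> D \<and>
    (\<exists>pre suf. rev (l x) = pre @ y # suf \<and> acc = foldl (\<lambda>acc y. f x y acc) (i x) pre)}"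
  have "ptime ?S (\<lambda>u. (fst u, snd (snd u), fst (snd u)))"
    by (intro ptime_intros)
  then show "ptime ?S (\<lambda>z. f (fst z) (snd (snd z)) (fst (snd z)))"
  proof (rule ptime_comp_eq[OF f])
    fix u assume "u \<in> ?S"
    then obtain x acc y pre suf where u: "u = (x, acc, y)" "x \<in> D"
      "rev (l x) = pre @ y # suf" "acc = foldl (\<lambda>acc y. f x y acc) (i x) pre"
      by auto
    then have "l x = rev suf @ y # rev pre \<and> acc = foldr (f x) (rev pre) (i x)"
      by (simp add: foldr_conv_foldl rev_swap)
    with u(1,2) have "(fst u, snd (snd u), fst (snd u)) \<in> {(x, y, acc). x \<in> D \<and>
      (\<exists>pre suf. l x = pre @ y # suf \<and> acc = foldr (f x) suf (i x))}"
      by (simp, metis)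
    then show "(fst u, snd (snd u), fst (snd u)) \<in> {(x, y, acc). x \<in> D \<and>
        (\<exists>pre suf. l x = pre @ y # suf \<and> acc = foldr (f x) suf (i x))} \<and>
      f (fst (fst u, snd (snd u), fst (snd u))) (fst (snd (fst u, snd (snd u), fst (snd u))))
        (snd (snd (fst u, snd (snd u), fst (snd u)))) = f (fst u) (snd (snd u)) (fst (snd u))"
      by simp
  qed
  fix x pre suf assume "x \<in> D" "rev (l x) = pre @ suf"
  then show "len (foldl (\<lambda>acc y. f x y acc) (i x) pre) \<le> B x"
    using size[of x "rev suf" "rev pre"] by (simp add: foldr_conv_foldl rev_swap)
qed

lemma ptime_append [ptime_intros]:
  assumes "ptime D f" "ptime D g"
  shows "ptime D (\<lambda>x. f x @ g x)"
proof -
  have foldr: "foldr (#) xs ys = xs @ ys" for xs ys :: "'b list"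
    by (induction xs) auto
  have "ptime D (\<lambda>x. foldr (#) (f x) (g x))"
    by (rule ptime_foldr[where B = "\<lambda>x. len (f x) + len (g x)"])
      (intro assms ptime_intros polybound_intros polybound_len | simp add: foldr len_append)+
  then show ?thesis by (simp add: foldr)
qed

lemma len_concat: "len (concat xss) \<le> len xss"
  by (induction xss) (auto simp: len_append)

lemma ptime_concat [ptime_intros]:
  assumes "ptime D f"
  shows "ptime D (\<lambda>x. concat (f x))"
  unfolding concat_conv_foldr
proof (rule ptime_foldr[where B = "\<lambda>x. len (f x)"])
  show "len (foldr (@) suf []) \<le> len (f x)" if "f x = pre @ suf" for x pre suf
    using that len_concat[of suf] by (simp add: len_append flip: concat_conv_foldr)
qed (intro assms ptime_intros polybound_len)+

lemma ptime_map [ptime_intros]: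
  assumes "ptime D l" "ptime {(x, y). x \<in> D \<and> y \<in> set (l x)} (\<lambda>z. g (fst z) (snd z))"
  shows "ptime D (\<lambda>x. map (g x) (l x))"
proof -
  obtain q where q: "\<And>x y. x \<in> D \<Longrightarrow> y \<in> set (l x) \<Longrightarrow> len (g x y) \<le> poly q (len (x, y))"
    using polybound_len[OF assms(2)] unfolding polybound_def by fastforce
  have foldr: "foldr (\<lambda>y acc. h y # acc) ys [] = map h ys" for h :: "'b \<Rightarrow> 'c" and ys
    by (induction ys) auto
  \<comment> \<open>The polynomial for \<open>g\<close> is evaluated at the length of the pair of
    \<open>x\<close> and an element, and an element is no longer than the whole list.\<close>
  let ?b = "\<lambda>x. poly q (2 * len x + 1 + len (l x))"
  have "ptime D (\<lambda>x. foldr (\<lambda>y acc. g x y # acc) (l x) [])"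
  proof (rule ptime_foldr[where B = "\<lambda>x. len (l x) * (2 * ?b x + 1)"])
    let ?S = "{(x, y, acc). x \<in> D \<and>
      (\<exists>pre suf. l x = pre @ y # suf \<and> acc = foldr (\<lambda>y acc. g x y # acc) suf [])}"
    have "ptime ?S (\<lambda>u. (fst u, fst (snd u)))"
      by (intro ptime_intros)
    then have "ptime ?S (\<lambda>u. g (fst u) (fst (snd u)))"
      by (rule ptime_comp_eq[OF assms(2)]) auto
    then show "ptime ?S (\<lambda>u. g (fst u) (fst (snd u)) # snd (snd u))"
      by (intro ptime_intros)
    show "polybound D (\<lambda>x. len (l x) * (2 * ?b x + 1))"
      by (intro polybound_intros polybound_poly polybound_len ptime_id assms)
    fix x pre suf assume x: "x \<in> D" "l x = pre @ suf"
    have b: "len y \<le> ?b x" if y: "y \<in> set (map (g x) suf)" for y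
    proof -
      obtain a where a: "a \<in> set (l x)" "y = g x a"
        using y x(2) by auto
      have "len (g x a) \<le> poly q (len (x, a))"
        by (rule q[OF x(1) a(1)])
      also have "\<dots> \<le> ?b x"
        by (rule poly_nat_mono) (use len_elem[OF a(1)] in simp)
      finally show ?thesis by (simp add: a)
    qed
    have "len (map (g x) suf) \<le> length (map (g x) suf) * (2 * ?b x + 1)"
      by (rule len_list_le) (rule b)
    also have "\<dots> \<le> len (l x) * (2 * ?b x + 1)"
      by (intro mult_mono) (use x(2) length_le_len[of "l x"] in auto)
    finally show "len (foldr (\<lambda>y acc. g x y # acc) suf []) \<le> len (l x) * (2 * ?b x + 1)"
      by (simp add: foldr)
  qed (intro assms ptime_intros)+
  then show ?thesis by (simp add: foldr)
qed

lemma len_filter: "len (filter P xs) \<le> len xs"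
  by (induction xs) auto

lemma ptime_filter [ptime_intros]:
  assumes "ptime D l" "ptime {(x, y). x \<in> D \<and> y \<in> set (l x)} (\<lambda>z. P (fst z) (snd z))"
  shows "ptime D (\<lambda>x. filter (P x) (l x))"
proof -
  have foldr: "foldr (\<lambda>y acc. if Q y then y # acc else acc) ys [] = filter Q ys"
    for Q :: "'b \<Rightarrow> bool" and ys
    by (induction ys) auto
  have "ptime D (\<lambda>x. foldr (\<lambda>y acc. if P x y then y # acc else acc) (l x) [])"
  proof (rule ptime_foldr[where B = "\<lambda>x. len (l x)"])
    let ?S = "{(x, y, acc). x \<in> D \<and> (\<exists>pre suf. l x = pre @ y # suf \<and>
      acc = foldr (\<lambda>y acc. if P x y then y # acc else acc) suf [])}"
    have "ptime ?S (\<lambda>u. (fst u, fst (snd u)))"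
      by (intro ptime_intros)
    then have "ptime ?S (\<lambda>u. P (fst u) (fst (snd u)))"
      by (rule ptime_comp_eq[OF assms(2)]) auto
    then show "ptime ?S (\<lambda>u. if P (fst u) (fst (snd u))
        then fst (snd u) # snd (snd u) else snd (snd u))"
      by (intro ptime_intros)
    fix x pre suf assume "l x = pre @ suf"
    then show "len (foldr (\<lambda>y acc. if P x y then y # acc else acc) suf []) \<le> len (l x)"
      using len_filter[of "P x" suf] by (simp add: foldr len_append)
  qed (intro assms ptime_intros polybound_len)+
  then show ?thesis by (simp add: foldr)
qed

lemma ptime_list_all [ptime_intros]:
  assumes "ptime D l" "ptime {(x, y). x \<in> D \<and> y \<in> set (l x)} (\<lambda>z. P (fst z) (snd z))"
  shows "ptime D (\<lambda>x. list_all (P x) (l x))"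
proof -
  have "ptime D (\<lambda>x. filter (\<lambda>y. \<not> P x y) (l x) = [])"
    by (intro ptime_intros assms)
  then show ?thesis
    by (rule ptime_cong) (auto simp: filter_empty_conv list_all_iff)
qed

text \<open>Numbers are represented by lengths of lists, so dropping \<open>length (l x)\<close>
  elements amounts to one \<open>tl\<close> per element of \<open>l x\<close>.\<close>

lemma ptime_drop [ptime_intros]:
  assumes "ptime D l" "ptime D f"
  shows "ptime D (\<lambda>x. drop (length (l x)) (f x))"
proof -
  have foldl: "foldl (\<lambda>zs _. tl zs) zs ys = drop (length ys) zs"
    for ys :: "'b list" and zs :: "'c list"
    by (induction ys arbitrary: zs) (auto simp: drop_Suc)
  have "ptime D (\<lambda>x. foldl (\<lambda>zs _. tl zs) (f x) (l x))"
    by (rule ptime_foldl[where B = "\<lambda>x. len (f x)"])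
      (intro assms ptime_intros polybound_len | simp add: foldl len_drop)+
  then show ?thesis by (simp add: foldl)
qed

lemma len_zip: "len (zip xs ys) \<le> 3 * len xs + len ys"
proof (induction xs arbitrary: ys)
  case (Cons x xs)
  then show ?case by (cases ys) (auto intro: order_trans[OF Cons.IH])
qed simp

text \<open>The fold runs along the first list and carries the pairs found so far, in reverse order,
  together with the rest of the second list.\<close>

lemma ptime_zip [ptime_intros]:
  assumes "ptime D l" "ptime D f"
  shows "ptime D (\<lambda>x. zip (l x) (f x))"
proof -
  let ?step = "\<lambda>acc y. if snd acc = [] then acc else ((y, hd (snd acc)) # fst acc, tl (snd acc))"
  have foldl: "foldl ?step (as, zs) ys = (rev (zip ys zs) @ as, drop (length ys) zs)"
    for as and ys :: "'b list" and zs :: "'c list"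
  proof (induction ys arbitrary: as zs)
    case (Cons y ys)
    then show ?case by (cases zs) auto
  qed simp
  have "ptime D (\<lambda>x. rev (fst (foldl ?step ([], f x) (l x))))"
  proof (intro ptime_rev ptime_fst
      ptime_foldl[where B = "\<lambda>x. 2 * (3 * len (l x) + len (f x)) + 1 + len (f x)"])
    fix x pre suf assume "l x = pre @ suf"
    then show "len (foldl ?step ([], f x) pre) \<le> 2 * (3 * len (l x) + len (f x)) + 1 + len (f x)"
      using len_zip[of pre "f x"] len_drop[of "length pre" "f x"]
      by (simp add: foldl len_rev len_append)
  qed (intro assms ptime_intros ptime_hd polybound_intros polybound_len | simp)+
  then show ?thesis by (simp add: foldl)
qed

lemma ptime_take [ptime_intros]:
  assumes "ptime D l" "ptime D f"
  shows "ptime D (\<lambda>x. take (length (l x)) (f x))"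
proof -
  have "ptime D (\<lambda>x. map fst (zip (f x) (l x)))"
    by (intro ptime_intros assms)
  then show ?thesis
    by (rule ptime_cong) (simp add: map_fst_zip_take min_def)
qed

lemma ptime_takeWhile [ptime_intros]:
  fixes f :: "'a :: encodable \<Rightarrow> bool list"
  assumes "ptime D f"
  shows "ptime D (\<lambda>x. takeWhile id (f x))"
proof -
  have foldr: "foldr (\<lambda>b acc. if b then b # acc else []) bs [] = takeWhile id bs" for bs
    by (induction bs) auto
  have len: "len (takeWhile id bs) \<le> len bs" for bs :: "bool list"
    by (induction bs) auto
  have "ptime D (\<lambda>x. foldr (\<lambda>b acc. if b then b # acc else []) (f x) [])"
  proof (rule ptime_foldr[where B = "\<lambda>x. len (f x)"])
    fix x pre suf assume "f x = pre @ suf"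
    then show "len (foldr (\<lambda>b acc. if b then b # acc else []) suf []) \<le> len (f x)"
      using len[of suf] by (simp add: foldr len_append)
  qed (intro assms ptime_intros polybound_len)+
  then show ?thesis by (simp add: foldr)
qed

lemma ptime_dropWhile [ptime_intros]:
  fixes f :: "'a :: encodable \<Rightarrow> bool list"
  assumes "ptime D f"
  shows "ptime D (\<lambda>x. dropWhile id (f x))"
proof -
  have "ptime D (\<lambda>x. drop (length (takeWhile id (f x))) (f x))"
    by (intro ptime_intros assms)
  then show ?thesis
    by (simp flip: dropWhile_eq_drop)
qed

section \<open>Programs as string functions\<close>

primrec clear_upto :: "nat \<Rightarrow> prog" where
  "clear_upto 0 = Skip"
| "clear_upto (Suc n) = Seq (clear_upto n) (clear (Suc n))"

lemma runs_clear_upto: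
  assumes "\<And>r. length (s r) \<le> B"
  shows "runs (clear_upto n) s (1 + n * (1 + B * 4)) (\<lambda>r. if 0 < r \<and> r \<le> n then [] else s r)"
proof (induction n)
  case 0
  have "(\<lambda>r. if 0 < r \<and> r \<le> 0 then [] else s r) = s" by auto
  then show ?case using runs_Skip[of s] by simp
next
  case (Suc n)
  let ?s = "\<lambda>r. if 0 < r \<and> r \<le> n then [] else s r"
  have 1: "runs (clear (Suc n)) ?s (1 + B * 4) (?s(Suc n := []))"
    by (rule runs_mono[OF runs_clear]) (use assms[of "Suc n"] in simp)
  have "?s(Suc n := []) = (\<lambda>r. if 0 < r \<and> r \<le> Suc n then [] else s r)"
    by auto
  with runs_Seq[OF Suc 1] show ?case
    by (auto elim!: runs_mono)
qed

text \<open>Determinism makes the described value unique on inputs on which the program halts; on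
  all others it is unspecified.\<close>

definition result :: "prog \<Rightarrow> bool list \<Rightarrow> bool list" where
  "result c w = (THE v. \<exists>t s. exec c (initial_store w) t s \<and> v = s 0)"

lemma result_eq: "exec c (initial_store w) t s \<Longrightarrow> result c w = s 0"
  unfolding result_def using exec_deterministic by blast

text \<open>No stack can be longer than the input plus the running time, so emptying the registers
  other than 0 that \<open>c\<close> may have used stays polynomial.\<close>

lemma polyrun_result:
  assumes "\<And>x. x \<in> D \<Longrightarrow>
    \<exists>t s. exec c (initial_store (i x)) t s \<and> t \<le> poly q (length (i x))"
  shows "polyrun D i (\<lambda>x. result c (i x))"
proof -
  obtain N where N: "regs c \<subseteq> {..<N}"
    using regs_below by blast
  let ?q = "q + [:1:] + smult N ([:1:] + smult 4 ([:0, 1:] + q))"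
  show ?thesis
  proof (rule polyrunI[where c = "Seq c (clear_upto N)" and q = ?q])
    fix x assume x: "x \<in> D"
    obtain t s where e: "exec c (initial_store (i x)) t s" and t: "t \<le> poly q (length (i x))"
      using assms[OF x] by blast
    have 1: "runs c (initial_store (i x)) (poly q (length (i x))) s"
      using e t unfolding runs_def by blast
    have "length (s r) \<le> length (i x) + poly q (length (i x))" for r
      using exec_length[OF e, of r] t by (simp add: initial_store_def split: if_splits)
    note 2 = runs_clear_upto[of s, OF this]
    have "s r = []" if "N < r" for r
      using exec_outside[OF e, of r] N that by (force simp: initial_store_def)
    then have "(\<lambda>r. if 0 < r \<and> r \<le> N then [] else s r) = initial_store (result c (i x))"
      unfolding result_eq[OF e] by (force simp: initial_store_def fun_eq_iff)
    with runs_Seq[OF 1 2[of N]]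
    show "runs (Seq c (clear_upto N)) (initial_store (i x)) (poly ?q (length (i x)))
        (initial_store (result c (i x)))"
      by (auto elim!: runs_mono simp: algebra_simps)
  qed
qed

lemma enc_bool_list: "enc (bs :: bool list) = concat (map (\<lambda>b. [True, b, False]) bs)"
  by (induction bs) (auto simp: enc_bool)

text \<open>Programs exchange raw bit strings, whereas the calculus works on encoded lists of bits.
  This conversion and its inverse form the interface; each bit becomes a marker, the bit itself and
  a separator.\<close>

lemma polyrun_pack: "polyrun D f (\<lambda>x. enc (f x))"
proof (rule polyrunI_linear)
  fix x assume "x \<in> D"
  let ?c = "\<lambda>b. Seq (Push 0 False) (Seq (Push 0 b) (Push 0 True))"
  let ?F = "\<lambda>b u. u(0 := True # b # False # u 0)"
  let ?s = "(initial_store [])(1 := rev (f x))"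
  have 1: "runs (move 0 1) (initial_store (f x)) (1 + length (f x) * 4) ?s"
    by (rule runs_eq[OF runs_move]) (auto simp: initial_store_def fun_eq_iff)
  have fold: "fold ?F bs s = s(0 := enc (rev bs) @ s 0)" for bs s
    by (induction bs arbitrary: s) (auto simp: enc_bool_list)
  have "runs (?c b) u 3 (?F b u)" for b u
    by (rule runs_eq, (rule runs_simple)+) auto
  then have "runs (drain 1 ?c) ?s (1 + length (?s 1) * (3 + 3)) ((fold ?F (?s 1) ?s)(1 := []))"
    by (rule runs_drain) (auto simp: fun_eq_iff)
  moreover have "(fold ?F (?s 1) ?s)(1 := []) = initial_store (enc (f x))"
    unfolding fold by (auto simp: initial_store_def fun_eq_iff)
  ultimately have 2: "runs (drain 1 ?c) ?s (1 + length (f x) * 6) (initial_store (enc (f x)))"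
    by simp
  show "runs (Seq (move 0 1) (drain 1 ?c)) (initial_store (f x)) (2 + 10 * length (f x))
      (initial_store (enc (f x)))"
    by (rule runs_mono[OF runs_Seq[OF 1 2]]) simp
qed

definition unpack :: prog where
  "unpack = While (Top 0) (Seq (Pop 0) (Seq (Cond (Top 0) (Push 1 True) (Push 1 False))
     (Seq (Pop 0) (Pop 0))))"

lemma runs_unpack:
  assumes "s 0 = enc bs"
  shows "runs unpack s (1 + length bs * 6) (s(0 := [], 1 := rev bs @ s 1))"
  using assms
proof (induction bs arbitrary: s)
  case Nil
  then have eq: "s(0 := [], 1 := rev [] @ s 1) = s" by auto
  have "runs unpack s 1 s"
    unfolding unpack_def by (rule runs_WhileFalse) (use Nil in simp)
  then show ?case by (rule runs_eq[OF _ _ eq[symmetric]]) simp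
next
  case (Cons a bs)
  let ?s = "s(0 := enc bs, 1 := a # s 1)"
  let ?s1 = "s(0 := a # False # enc bs)"
  let ?s2 = "?s1(1 := a # ?s1 1)"
  let ?s3 = "s(0 := False # enc bs, 1 := a # s 1)"
  have 1: "runs (Pop 0) s 1 ?s1"
    using runs_Pop[of 0 s] Cons.prems by (simp add: enc_bool)
  have 2: "runs (Cond (Top 0) (Push 1 True) (Push 1 False)) ?s1 (1 + 1) ?s2"
    by (intro runs_Cond) (use runs_Push[of 1 a ?s1] in \<open>cases a; simp\<close>)+
  have 3: "runs (Pop 0) ?s2 1 ?s3" "runs (Pop 0) ?s3 1 ?s"
    by (rule runs_eq[OF runs_Pop]; auto simp: fun_eq_iff)+
  have 4: "runs unpack ?s (1 + length bs * 6) (?s(0 := [], 1 := rev bs @ ?s 1))"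
    by (rule Cons.IH) simp
  note runs_Seq[OF 1 runs_Seq[OF 2 runs_Seq[OF 3]]]
  then have "runs unpack s (1 + (1 + (1 + 1 + (1 + 1))) + (1 + length bs * 6))
      (?s(0 := [], 1 := rev bs @ ?s 1))"
    unfolding unpack_def
    by (rule runs_WhileTrue[rotated, OF _ 4[unfolded unpack_def]])
      (use Cons.prems in \<open>simp add: enc_bool\<close>)
  then show ?case
    by (rule runs_eq) (auto simp: fun_eq_iff)
qed

lemma polyrun_unpack: "polyrun D (\<lambda>x. enc (f x)) f" for f :: "'x \<Rightarrow> bool list"
proof (rule polyrunI_linear)
  fix x assume "x \<in> D"
  let ?s = "(initial_store [])(1 := rev (f x))"
  have 1: "runs unpack (initial_store (enc (f x))) (1 + length (f x) * 6) ?s"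
    by (rule runs_eq[OF runs_unpack]) (auto simp: initial_store_def fun_eq_iff)
  have 2: "runs (move 1 0) ?s (1 + length (f x) * 4) (initial_store (f x))"
    by (rule runs_eq[OF runs_move]) (auto simp: initial_store_def fun_eq_iff)
  show "runs (Seq unpack (move 1 0)) (initial_store (enc (f x))) (2 + 10 * len (f x))
      (initial_store (f x))"
    by (rule runs_mono[OF runs_Seq[OF 1 2]]) (use length_le_len[of "f x"] in simp)
qed

text \<open>The domain consists of the encodings of elements of \<open>D\<close>, where the program
  is guaranteed to halt in time.\<close>

lemma ptime_result:
  assumes "\<And>x. x \<in> D \<Longrightarrow>
    \<exists>t s. exec c (initial_store (i x)) t s \<and> t \<le> poly q (length (i x))"
  shows "ptime (i ` D) (result c)"
proof -
  have "polyrun (i ` D) enc (\<lambda>w. w)"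
    by (rule polyrun_unpack)
  also have "polyrun (i ` D) (\<lambda>w. w) (result c)"
    by (rule polyrun_result[where q = q]) (use assms in auto)
  also have "polyrun (i ` D) (result c) (\<lambda>w. enc (result c w))"
    by (rule polyrun_pack)
  finally show ?thesis unfolding ptime_def .
qed

lemma ptime_polyrun:
  assumes "ptime D f"
  shows "polyrun D (\<lambda>w. w) f"
  using polyrun_trans[OF polyrun_trans[OF polyrun_pack assms[unfolded ptime_def]] polyrun_unpack] .

section \<open>The greedy algorithm\<close>

text \<open>Unary numbers are lists of \<open>True\<close>.  The state of the greedy algorithm for a fixed guess \<open>k\<close>
  consists of the rows of the incidence matrix, each marked with whether its hyperedge has been
  picked, the number of hyperedges still to be picked, and \<open>k\<close> times the number of rounds that
  picked something so far, which bounds the size of the union of the picked hyperedges.\<close>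

type_synonym state = "(bool list \<times> bool) list \<times> bool list \<times> bool list"

definition row_subset :: "bool list \<Rightarrow> bool list \<Rightarrow> bool" where
  "row_subset v w \<longleftrightarrow> list_all (\<lambda>z. \<not> (fst z \<and> \<not> snd z)) (zip v w)"

definition free_rows :: "(bool list \<times> bool) list \<Rightarrow> bool list list" where
  "free_rows tab = map fst (filter (\<lambda>z. \<not> snd z) tab)"

text \<open>This imitates \<open>encode\<close> for the hypergraph of the unpicked hyperedges; the
  constant map over the free rows writes their number in unary.\<close>

definition query :: "bool list \<Rightarrow> bool list \<Rightarrow> (bool list \<times> bool) list \<Rightarrow> bool list" where
  "query us ks tab =
     us @ False # map (\<lambda>_. True) (free_rows tab) @ False # ks @ False # concat (free_rows tab)"

text \<open>The test of the counter caps the total at \<open>p\<close>. Picked rows are marked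
  rather than removed, so the positions in the table keep matching the hyperedge list and the marks
  become the answer.\<close>

definition pick_row ::
  "bool list \<Rightarrow> bool list \<times> bool \<Rightarrow> (bool list \<times> bool) list \<times> bool list
    \<Rightarrow> (bool list \<times> bool) list \<times> bool list" where
  "pick_row w z s =
     (if \<not> snd z \<and> snd s \<noteq> [] \<and> row_subset (fst z) w
      then ((fst z, True) # fst s, tl (snd s)) else (z # fst s, snd s))"

definition pick ::
  "bool list \<Rightarrow> (bool list \<times> bool) list \<Rightarrow> bool list \<Rightarrow> (bool list \<times> bool) list \<times> bool list" where
  "pick w tab cnt = foldr (pick_row w) tab ([], cnt)"

definition step_state ::
  "bool list \<Rightarrow> state \<Rightarrow> (bool list \<times> bool) list \<times> bool list \<Rightarrow> state" where
  "step_state ks st s = (fst s, snd s, ks @ snd (snd st))"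

text \<open>A round begun with an unfinished counter is charged \<open>k\<close> even if it picks
  nothing. Finished states are fixed points, so a predetermined number of rounds can be run.\<close>

definition greedy_round ::
  "(bool list \<Rightarrow> bool list) \<Rightarrow> bool list \<Rightarrow> bool list \<Rightarrow> state \<Rightarrow> state" where
  "greedy_round a us ks st =
     (if fst (snd st) = [] then st
      else step_state ks st (pick (a (query us ks (fst st))) (fst st) (fst (snd st))))"

text \<open>The list of rows only counts the rounds. There are at least \<open>p\<close> rows, and
  under the right guess every unfinished round picks a hyperedge, so this many rounds
  suffice.\<close>

definition greedy ::
  "(bool list \<Rightarrow> bool list) \<Rightarrow> bool list \<Rightarrow> bool list \<Rightarrow> bool list list \<Rightarrow> bool list \<Rightarrow> state" where
  "greedy a us ps rows ks =
     foldl (\<lambda>st _. greedy_round a us ks st) (map (\<lambda>r. (r, False)) rows, ps, []) rows"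

text \<open>Charges are unary, so a nonempty rest after \<open>drop\<close> says that
  \<open>t\<close> is strictly cheaper than \<open>s\<close>.\<close>

definition cheapest :: "state list \<Rightarrow> state" where
  "cheapest sts =
     (if sts = [] then ([], [], [])
      else foldl (\<lambda>s t. if \<not> drop (length (snd (snd t))) (snd (snd s)) = [] then t else s)
        (hd sts) (tl sts))"

definition guesses :: "bool list \<Rightarrow> bool list list" where
  "guesses us = foldl (\<lambda>acc _. [] # map (\<lambda>ks. True # ks) acc) [[]] us"

text \<open>Only runs that end with an empty counter, hence with \<open>p\<close> picked hyperedges,
  take part in the comparison.\<close>

definition solve :: "(bool list \<Rightarrow> bool list) \<Rightarrow> bool list \<times> bool list \<times> bool list list \<Rightarrow> bool list" where
  "solve a x = map snd (fst (cheapest (filter (\<lambda>st. fst (snd st) = [])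
     (map (\<lambda>ks. greedy a (fst x) (fst (snd x)) (snd (snd x)) ks) (guesses (fst x))))))"

text \<open>The number of rows comes from \<open>ms\<close>, since it cannot be read off
  \<open>w\<close> when there are no vertices and all rows are empty.\<close>

definition split_rows :: "bool list \<Rightarrow> bool list \<Rightarrow> bool list \<Rightarrow> bool list list" where
  "split_rows us ms w = rev (fst (foldl (\<lambda>s _. (take (length us) (snd s) # fst s,
     drop (length us) (snd s))) ([], w) ms))"

definition after_unary :: "bool list \<Rightarrow> bool list" where
  "after_unary w = tl (dropWhile id w)"

definition parse :: "bool list \<Rightarrow> bool list \<times> bool list \<times> bool list list" where
  "parse w = (takeWhile id w,
     takeWhile id (after_unary (after_unary w)),
     split_rows (takeWhile id w) (takeWhile id (after_unary w))
       (after_unary (after_unary (after_unary w))))"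


section \<open>Correctness\<close>

abbreviation ones :: "nat \<Rightarrow> bool list" where
  "ones n \<equiv> replicate n True"

fun rows_of :: "inst \<Rightarrow> bool list \<times> bool list \<times> bool list list" where
  "rows_of (n, es, p) = (ones n, ones p, map (char_vec [0..<n]) es)"

definition table :: "nat \<Rightarrow> nat set list \<Rightarrow> nat set set \<Rightarrow> (bool list \<times> bool) list" where
  "table n es P = map (\<lambda>e. (char_vec [0..<n] e, e \<in> P)) es"

text \<open>The invariant shape of the greedy states: \<open>P\<close> is the set of picked
  hyperedges and \<open>T\<close> the number of rounds charged so far.\<close>

definition state_of :: "inst \<Rightarrow> nat \<Rightarrow> nat set set \<Rightarrow> nat \<Rightarrow> state" where
  "state_of x k P T =
     (case x of (n, es, p) \<Rightarrow> (table n es P, ones (p - card P), ones (k * T)))"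

section \<open>Parsing, queries and the shape of the greedy states\<close>

lemma takeWhile_unary: "takeWhile id (unary k @ w) = ones k"
  unfolding unary_def by (induction k) auto

lemma after_unary_unary: "after_unary (unary k @ w) = w"
  unfolding after_unary_def unary_def by (induction k) auto

lemma length_char_vec [simp]: "length (char_vec xs S) = length xs"
  by (simp add: char_vec_def)

lemma split_rows_concat:
  assumes "\<And>r. r \<in> set rows \<Longrightarrow> length r = length us" "length ms = length rows"
  shows "split_rows us ms (concat rows) = rows"
proof -
  let ?f = "\<lambda>s _. (take (length us) (snd s) # fst s, drop (length us) (snd s))"
  have "foldl ?f (acc, concat rows) ms = (rev rows @ acc, [])" for acc
    using assms
  proof (induction rows arbitrary: acc ms)
    case (Cons r rows)
    then show ?case by (cases ms) auto
  qed simp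
  then show ?thesis
    by (simp add: split_rows_def)
qed

lemma parse_encode: "parse (encode x) = rows_of x"
proof -
  obtain n es p where x: "x = (n, es, p)" by (cases x)
  have "split_rows (ones n) (ones (length es)) (concat (map (char_vec [0..<n]) es))
      = map (char_vec [0..<n]) es"
    by (rule split_rows_concat) auto
  then show ?thesis
    by (simp add: x parse_def takeWhile_unary after_unary_unary)
qed

lemma query_table:
  "query (ones n) (ones k) (table n es P) = encode (n, filter (\<lambda>e. e \<notin> P) es, k)"
proof -
  have "free_rows (table n es P) = map (char_vec [0..<n]) (filter (\<lambda>e. e \<notin> P) es)"
    by (induction es) (auto simp: free_rows_def table_def)
  then show ?thesis
    by (simp add: query_def unary_def map_replicate_const)
qed

lemma guesses_eq: "guesses us = map ones [0..<Suc (length us)]"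
  unfolding guesses_def
proof (induction us rule: rev_induct)
  case (snoc u us)
  have "map ones [0..<Suc (Suc m)] = [] # map (\<lambda>ks. True # ks) (map ones [0..<Suc m])" for m
    by (induction m) auto
  then show ?case
    by (simp only: foldl_append foldl_Cons foldl_Nil snoc length_append
        list.size add_0 add_Suc_right add_0_right)
qed simp

lemma set_guesses: "set (guesses us) = {ones k | k. k \<le> length us}"
  by (auto simp: guesses_eq less_Suc_eq_le image_def)

text \<open>\<open>N\<close> is the set of newly picked hyperedges and \<open>C es\<close> the set
  of candidates. Either all candidates are picked or the counter is used up. The right fold treats
  the head last, which fits induction on the list.\<close>

lemma pick_table:
  fixes w n P
  defines "C es \<equiv> {e \<in> set es. e \<notin> P \<and> row_subset (char_vec [0..<n] e) w}"
  assumes "distinct es"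
  shows "\<exists>N \<subseteq> C es. card N \<le> length cnt \<and> (card N < length cnt \<longrightarrow> N = C es) \<and>
    pick w (table n es P) cnt = (table n es (P \<union> N), drop (card N) cnt)"
  using assms(2)
proof (induction es)
  case Nil
  then show ?case by (auto simp: C_def pick_def table_def)
next
  case (Cons e es)
  then obtain N where N: "N \<subseteq> C es" "card N \<le> length cnt" "card N < length cnt \<longrightarrow> N = C es"
    "pick w (table n es P) cnt = (table n es (P \<union> N), drop (card N) cnt)"
    by auto
  have fin: "finite N" "e \<notin> N"
    using N(1) Cons.prems finite_subset by (fastforce simp: C_def)+
  have tab: "table n es (P \<union> insert e N) = table n es (P \<union> N)"
    using Cons.prems by (auto simp: table_def)
  have pick: "pick w (table n (e # es) P) cnt =
      pick_row w (char_vec [0..<n] e, e \<in> P) (table n es (P \<union> N), drop (card N) cnt)"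
    using N(4) by (simp add: pick_def table_def)
  show ?case
  proof (cases "e \<notin> P \<and> card N < length cnt \<and> row_subset (char_vec [0..<n] e) w")
    case True
    then have "pick w (table n (e # es) P) cnt =
        (table n (e # es) (P \<union> insert e N), drop (card (insert e N)) cnt)"
      using fin tab by (simp add: pick pick_row_def drop_Suc tl_drop) (simp add: table_def)
    moreover have "insert e N = C (e # es)"
      using N(3) True by (auto simp: C_def)
    moreover have "card (insert e N) \<le> length cnt"
      using True fin by simp
    ultimately show ?thesis
      by (intro exI[of _ "insert e N"]) auto
  next
    case False
    then have "pick w (table n (e # es) P) cnt = (table n (e # es) (P \<union> N), drop (card N) cnt)"
      using fin by (auto simp: pick pick_row_def) (auto simp: table_def)
    moreover have "C es \<subseteq> C (e # es)" "card N < length cnt \<longrightarrow> C (e # es) = C es"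
      using False by (auto simp: C_def)
    ultimately show ?thesis
      using N by (intro exI[of _ N]) auto
  qed
qed

text \<open>Hides the table: from here on a round is a transition from \<open>P\<close>,
  \<open>T\<close> to \<open>P \<union> N\<close>, \<open>Suc T\<close>, where \<open>N\<close> can
  miss hyperedges of \<open>C\<close> only if \<open>p\<close> has been reached.\<close>

lemma greedy_round_state:
  fixes a n k es P
  defines "w \<equiv> a (encode (n, filter (\<lambda>e. e \<notin> P) es, k))"
  defines "C \<equiv> {e \<in> set es. e \<notin> P \<and> row_subset (char_vec [0..<n] e) w}"
  assumes "distinct es" "P \<subseteq> set es" "card P < p"
  shows "\<exists>N \<subseteq> C. card (P \<union> N) = card P + card N \<and> card (P \<union> N) \<le> p \<and>
    (card (P \<union> N) < p \<longrightarrow> N = C) \<and>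
    greedy_round a (ones n) (ones k) (state_of (n, es, p) k P T)
      = state_of (n, es, p) k (P \<union> N) (Suc T)"
proof -
  obtain N where N: "N \<subseteq> C" "card N \<le> p - card P" "card N < p - card P \<longrightarrow> N = C"
    "pick w (table n es P) (ones (p - card P))
      = (table n es (P \<union> N), drop (card N) (ones (p - card P)))"
    using pick_table[OF assms(3), where w = w and n = n and P = P and cnt = "ones (p - card P)"]
    unfolding C_def length_replicate by blast
  have "finite P" "finite N" "P \<inter> N = {}"
    using assms(4) N(1) unfolding C_def by (auto intro: finite_subset)
  then have card: "card (P \<union> N) = card P + card N"
    by (rule card_Un_disjoint)
  have "fst (snd (state_of (n, es, p) k P T)) \<noteq> []"
    using assms(5) by (simp add: state_of_def)
  then have "greedy_round a (ones n) (ones k) (state_of (n, es, p) k P T)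
      = step_state (ones k) (state_of (n, es, p) k P T) (pick w (table n es P) (ones (p - card P)))"
    unfolding greedy_round_def w_def by (simp only: state_of_def prod.case fst_conv snd_conv
      query_table if_False)
  also have "\<dots> = state_of (n, es, p) k (P \<union> N) (Suc T)"
    unfolding N(4) by (simp add: step_state_def state_of_def card replicate_add)
  finally show ?thesis
    using N(1-3) card assms(5) by (intro exI[of _ N]) auto
qed

lemma greedy_round_finished:
  assumes "p \<le> card P"
  shows "greedy_round a us ks (state_of (n, es, p) k P T) = state_of (n, es, p) k P T"
  using assms by (simp add: greedy_round_def state_of_def)

lemma foldl_const: "foldl (\<lambda>s _. g s) s xs = (g ^^ length xs) s"
  by (induction xs arbitrary: s) (auto simp: funpow_swap1)

text \<open>The states keep their shape whatever \<open>a\<close> answers. For the running time this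
  is enough to bound their size and to recognize the queries as encoded instances.\<close>

lemma greedy_prefix:
  assumes "(n, es, p) \<in> mpu_instances"
  shows "\<exists>P T. P \<subseteq> set es \<and> card P \<le> p \<and> T \<le> j \<and>
    (greedy_round a (ones n) (ones k) ^^ j) (state_of (n, es, p) k {} 0)
      = state_of (n, es, p) k P T"
proof (induction j)
  case 0
  show ?case by (auto intro!: exI[of _ "{}"] exI[of _ 0])
next
  case (Suc j)
  then obtain P T where PT: "P \<subseteq> set es" "card P \<le> p" "T \<le> j"
    "(greedy_round a (ones n) (ones k) ^^ j) (state_of (n, es, p) k {} 0)
      = state_of (n, es, p) k P T"
    by blast
  show ?case
  proof (cases "card P < p")
    case True
    have "distinct es"
      using assms by (simp add: mpu_instances_def)
    from greedy_round_state[OF this PT(1) True, of n a k T] obtain N where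
      "N \<subseteq> set es" "card (P \<union> N) \<le> p" "greedy_round a (ones n) (ones k) (state_of (n, es, p) k P T)
        = state_of (n, es, p) k (P \<union> N) (Suc T)"
      by blast
    with PT show ?thesis
      by (intro exI[of _ "P \<union> N"] exI[of _ "Suc T"]) auto
  next
    case False
    with PT show ?thesis
      by (intro exI[of _ P] exI[of _ T]) (auto simp: greedy_round_finished)
  qed
qed

lemma row_subset_char_vec:
  assumes "e \<subseteq> {..<n}"
  shows "row_subset (char_vec [0..<n] e) (char_vec [0..<n] W) \<longleftrightarrow> e \<subseteq> W"
proof -
  have "zip (char_vec xs e) (char_vec xs W) = map (\<lambda>i. (i \<in> e, i \<in> W)) xs" for xs :: "nat list"
    by (induction xs) (auto simp: char_vec_def)
  then show ?thesis
    using assms by (auto simp: row_subset_def list_all_iff)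
qed

section \<open>The approximation guarantee\<close>

lemma mpu_opt_attained:
  assumes "hypergraph V E" "p \<le> card E"
  obtains S where "S \<subseteq> E" "card S = p" "card (\<Union>S) = mpu_opt E p"
proof -
  have "mpu_opt E p \<in> {card (\<Union>E') | E'. E' \<subseteq> E \<and> card E' = p}"
    unfolding mpu_opt_def
    by (intro Min_in mpu_feasible[OF assms(1)] iffD2[OF mpu_feasible(2)[OF assms(1)]] assms(2))
  then show ?thesis using that by auto
qed

text \<open>The hyperedges of an optimal solution that have not been picked show that the residual
  hypergraph still has a dense set of \<open>mpu_opt E p\<close> vertices.\<close>

lemma dksh_opt_residual:
  assumes "hypergraph V E" "p \<le> card E" "P \<subseteq> E"
  shows "p - card P \<le> dksh_opt V (E - P) (mpu_opt E p)"
proof -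
  obtain S where S: "S \<subseteq> E" "card S = p" "card (\<Union>S) = mpu_opt E p"
    using mpu_opt_attained[OF assms(1,2)] by blast
  have fin: "finite E" "finite V" and sub: "\<Union>S \<subseteq> V" and hyp: "hypergraph V (E - P)"
    using assms(1) S(1) finite_subset[of E "Pow V"] by (auto simp: hypergraph_def)
  have "p - card P \<le> card (S - P)"
    using S(2) diff_card_le_card_Diff[of P S] assms(3) fin finite_subset by blast
  also have "\<dots> \<le> card (edges_within (E - P) (\<Union>S))"
    using S(1) fin by (intro card_mono) (auto simp: edges_within_def)
  also have "\<dots> \<le> dksh_opt V (E - P) (mpu_opt E p)"
    unfolding dksh_opt_def
    by (rule Max_ge[OF dksh_feasible(1)[OF hyp]]) (use sub S(3) in blast)
  finally show ?thesis .
qed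

text \<open>Here \<open>a\<close> is an arbitrary function, so the quality of the answers is
  separated from running times. \<open>solver\<close> speaks of all instances because the queries
  concern residual hypergraphs of the fixed instance.\<close>

locale dksh_solver =
  fixes a :: "bool list \<Rightarrow> bool list" and f :: "nat set \<Rightarrow> nat set set \<Rightarrow> real"
    and n :: nat and es :: "nat set list" and p :: nat
  assumes inst: "(n, es, p) \<in> mpu_instances"
    and ratio: "approx_ratio f"
    and solver: "\<And>x. x \<in> dksh_instances \<Longrightarrow>
      (case x of (m, es', k) \<Rightarrow> \<exists>W. a (encode x) = char_vec [0..<m] W \<and>
        dksh_approx (f {..<m} (set es')) {..<m} (set es') k W)"
begin

abbreviation "E \<equiv> set es"
abbreviation "F \<equiv> f {..<n} E"
abbreviation "opt \<equiv> mpu_opt E p"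

lemma hyper: "hypergraph {..<n} E" "distinct es" "p \<le> card E" "E \<subseteq> Pow {..<n}"
  using inst by (auto simp: mpu_instances_def distinct_card hypergraph_def)

lemma ratio_ge_1: "1 \<le> F"
  using ratio hyper(1) by (auto simp: approx_ratio_def)

lemma opt_le: "opt \<le> n"
proof -
  obtain S where "S \<subseteq> E" "card (\<Union>S) = opt"
    using mpu_opt_attained[OF hyper(1,3)] by blast
  moreover from this have "\<Union>S \<subseteq> {..<n}"
    using hyper(4) by blast
  ultimately show ?thesis
    using card_mono[of "{..<n}" "\<Union>S"] by simp
qed

text \<open>The answer is for the hypergraph \<open>E - P\<close>, whose ratio is at most
  \<open>F\<close> by monotonicity. All new hyperedges lie in \<open>W\<close>, so the union grows
  by at most \<open>k\<close> vertices; the density bound requires that the round was not cut short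
  by the counter.\<close>

lemma greedy_round_picks:
  assumes "k \<le> n" "P \<subseteq> E" "card P < p"
  obtains N W where "N \<subseteq> E" "\<Union>N \<subseteq> W" "finite W" "card W = k"
    "card (P \<union> N) \<le> p" "card (P \<union> N) = card P + card N"
    "card (P \<union> N) < p \<Longrightarrow> real (dksh_opt {..<n} (E - P) k) / F \<le> real (card N)"
    "greedy_round a (ones n) (ones k) (state_of (n, es, p) k P T)
      = state_of (n, es, p) k (P \<union> N) (Suc T)"
proof -
  let ?es = "filter (\<lambda>e. e \<notin> P) es"
  let ?r = "f {..<n} (E - P)"
  have set: "set ?es = E - P" by auto
  have hyp: "hypergraph {..<n} (E - P)"
    using hyper(4) by (auto simp: hypergraph_def)
  then have "(n, ?es, k) \<in> dksh_instances"
    using hyper(2) assms(1) by (simp add: dksh_instances_def set del: set_filter)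
  from solver[OF this] obtain W where W: "a (encode (n, ?es, k)) = char_vec [0..<n] W"
    "dksh_approx ?r {..<n} (E - P) k W"
    unfolding prod.case set by blast
  have C: "{e \<in> E. e \<notin> P \<and> row_subset (char_vec [0..<n] e) (a (encode (n, ?es, k)))}
      = edges_within (E - P) W"
  proof -
    have "row_subset (char_vec [0..<n] e) (char_vec [0..<n] W) \<longleftrightarrow> e \<subseteq> W" if "e \<in> E" for e
      using hyper(4) that by (intro row_subset_char_vec) auto
    then show ?thesis
      unfolding W(1) edges_within_def by auto
  qed
  note round = greedy_round_state[OF hyper(2) assms(2,3), of n a k T, unfolded C]
  then obtain N where N: "N \<subseteq> edges_within (E - P) W" "card (P \<union> N) \<le> p"
    "card (P \<union> N) < p \<longrightarrow> N = edges_within (E - P) W" "card (P \<union> N) = card P + card N"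
    "greedy_round a (ones n) (ones k) (state_of (n, es, p) k P T)
      = state_of (n, es, p) k (P \<union> N) (Suc T)"
    by (elim exE conjE)
  have r: "1 \<le> ?r" "?r \<le> F"
    using ratio hyp hyper(1) by (simp_all add: approx_ratio_def)
  have "real (dksh_opt {..<n} (E - P) k) / F \<le> real (dksh_opt {..<n} (E - P) k) / ?r"
    using r by (intro divide_left_mono) auto
  also have "\<dots> \<le> real (card (edges_within (E - P) W))"
    using W(2) by (simp add: dksh_approx_def)
  finally have dense: "real (dksh_opt {..<n} (E - P) k) / F \<le> real (card (edges_within (E - P) W))" .
  show ?thesis
  proof (rule that[of N W])
    show "N \<subseteq> E" "\<Union>N \<subseteq> W"
      using N(1) by (auto simp: edges_within_def)
    show "finite W" "card W = k"
      using W(2) finite_subset[of W "{..<n}"] by (auto simp: dksh_approx_def)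
  qed (use N dense in auto)
qed

text \<open>Every charged round adds only subsets of one set of \<open>k\<close> vertices, whatever
  the guess. So selecting a run by its charge never underestimates its union.\<close>

lemma greedy_union:
  assumes "k \<le> n"
  shows "\<exists>P T. P \<subseteq> E \<and> card P \<le> p \<and> card (\<Union>P) \<le> k * T \<and>
    (greedy_round a (ones n) (ones k) ^^ j) (state_of (n, es, p) k {} 0)
      = state_of (n, es, p) k P T"
proof (induction j)
  case 0
  show ?case by (auto intro!: exI[of _ "{}"] exI[of _ 0])
next
  case (Suc j)
  then obtain P T where PT: "P \<subseteq> E" "card P \<le> p" "card (\<Union>P) \<le> k * T"
    "(greedy_round a (ones n) (ones k) ^^ j) (state_of (n, es, p) k {} 0)
      = state_of (n, es, p) k P T"
    by blast
  show ?case
  proof (cases "card P < p")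
    case True
    obtain N W where N: "N \<subseteq> E" "\<Union>N \<subseteq> W" "finite W" "card W = k" "card (P \<union> N) \<le> p"
      "greedy_round a (ones n) (ones k) (state_of (n, es, p) k P T)
        = state_of (n, es, p) k (P \<union> N) (Suc T)"
      using greedy_round_picks[OF assms PT(1) True, of T] by metis
    have "card (\<Union>(P \<union> N)) \<le> card (\<Union>P) + card (\<Union>N)"
      by (simp add: card_Un_le)
    also have "\<dots> \<le> k * T + k"
      using PT(3) card_mono[OF N(3,2)] N(4) by simp
    finally have "card (\<Union>(P \<union> N)) \<le> k * Suc T" by simp
    with PT N show ?thesis
      by (intro exI[of _ "P \<union> N"] exI[of _ "Suc T"]) auto
  next
    case False
    with PT show ?thesis
      by (intro exI[of _ P] exI[of _ T]) (auto simp: greedy_round_finished)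
  qed
qed

text \<open>The bounds serve different ends: the linear one shows that \<open>p\<close> rounds
  finish, the geometric one describes the decay, and the one with \<open>T - 1\<close> records that
  something was missing before the last charged round, which will bound \<open>T\<close>.\<close>

lemma greedy_opt:
  fixes q :: real
  defines "q \<equiv> 1 - 1 / F"
  shows "\<exists>P T. P \<subseteq> E \<and> card P \<le> p \<and> p - card P \<le> p - j \<and>
    real (p - card P) \<le> p * q ^ T \<and> (T = 0 \<or> 1 \<le> p * q ^ (T - 1)) \<and>
    (greedy_round a (ones n) (ones opt) ^^ j) (state_of (n, es, p) opt {} 0)
      = state_of (n, es, p) opt P T"
proof (induction j)
  case 0
  show ?case by (auto intro!: exI[of _ "{}"] exI[of _ 0])
next
  case (Suc j)
  have q: "0 \<le> q" "q \<le> 1"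
    using ratio_ge_1 by (auto simp: q_def)
  from Suc obtain P T where PT: "P \<subseteq> E" "card P \<le> p" "p - card P \<le> p - j"
    "real (p - card P) \<le> p * q ^ T" "T = 0 \<or> 1 \<le> p * q ^ (T - 1)"
    "(greedy_round a (ones n) (ones opt) ^^ j) (state_of (n, es, p) opt {} 0)
      = state_of (n, es, p) opt P T"
    by blast
  show ?case
  proof (cases "card P < p")
    case True
    obtain N where N: "N \<subseteq> E" "card (P \<union> N) \<le> p" "card (P \<union> N) = card P + card N"
      "card (P \<union> N) < p \<Longrightarrow> real (dksh_opt {..<n} (E - P) opt) / F \<le> real (card N)"
      "greedy_round a (ones n) (ones opt) (state_of (n, es, p) opt P T)
        = state_of (n, es, p) opt (P \<union> N) (Suc T)"
      using greedy_round_picks[OF opt_le PT(1) True, of T] by metis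
    have *: "p - card (P \<union> N) \<le> p - Suc j \<and> real (p - card (P \<union> N)) \<le> p * q ^ Suc T"
    proof (cases "card (P \<union> N) < p")
      case False
      then show ?thesis using q(1) by simp
    next
      case less: True
      have "real (p - card P) / F \<le> real (dksh_opt {..<n} (E - P) opt) / F"
        using dksh_opt_residual[OF hyper(1,3) PT(1)] ratio_ge_1 by (intro divide_right_mono) auto
      with N(4)[OF less] have dense: "real (p - card P) / F \<le> real (card N)"
        by simp
      moreover have "0 < real (p - card P) / F"
        using True ratio_ge_1 by simp
      \<comment> \<open>Thus a round that does not finish picks at least one hyperedge, which yields
        the linear bound.\<close>
      ultimately have "0 < card N" by linarith
      have "real (p - card (P \<union> N)) \<le> real (p - card P) * q"
        using N(2,3) dense less by (simp add: q_def field_simps of_nat_diff)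
      also have "\<dots> \<le> p * q ^ T * q"
        using PT(4) q(1) by (intro mult_right_mono) auto
      finally show ?thesis
        using \<open>0 < card N\<close> N(2,3) PT(3) True by (auto simp: algebra_simps)
    qed
    \<comment> \<open>At least one hyperedge was missing before this round.\<close>
    have "1 \<le> p * q ^ T"
      using PT(4) True by linarith
    with * PT N(1,2,5) show ?thesis
      by (intro exI[of _ "P \<union> N"] exI[of _ "Suc T"]) auto
  next
    case False
    with PT show ?thesis
      by (intro exI[of _ P] exI[of _ T]) (auto simp: greedy_round_finished)
  qed
qed

text \<open>From \<open>1 - 1 / F \<le> exp (- (1 / F))\<close> the second alternative yields
  \<open>T - 1 \<le> F * ln p\<close>. The remaining round is absorbed by the factor 2, since
  \<open>F\<close> and the logarithm are at least 1.\<close>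

lemma rounds_bound:
  assumes "T = 0 \<or> 1 \<le> p * (1 - 1 / F) ^ (T - 1)"
  shows "real T \<le> 2 * F * log 2 (real (max 2 p))"
proof (cases "T = 0")
  case True
  then show ?thesis using ratio_ge_1 by (simp add: zero_le_log_cancel_iff)
next
  case False
  let ?q = "1 - 1 / F"
  have "0 \<le> ?q" "?q \<le> exp (- (1 / F))"
    using ratio_ge_1 exp_ge_add_one_self[of "- (1 / F)"] by auto
  then have "?q ^ (T - 1) \<le> exp (- (1 / F)) ^ (T - 1)"
    by (intro power_mono)
  also have "\<dots> = exp (- (real (T - 1) / F))"
    by (simp flip: exp_of_nat_mult)
  finally have "1 \<le> p * exp (- (real (T - 1) / F))"
    using assms False by (smt (verit) mult_left_mono of_nat_0_le_iff)
  then have "exp (real (T - 1) / F) \<le> p"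
    by (simp add: exp_minus field_simps)
  moreover from this have p: "0 < real p"
    using exp_gt_zero[of "real (T - 1) / F"] by linarith
  ultimately have "real (T - 1) / F \<le> ln p"
    by (simp add: ln_ge_iff)
  also have "ln (real p) \<le> ln (real (max 2 p))"
    using p by simp
  also have "\<dots> \<le> log 2 (real (max 2 p))"
  proof -
    have "0 < ln (2 :: real)" "ln (2 :: real) \<le> 1" "0 \<le> ln (real (max 2 p))"
      using ln_2_less_1 by simp_all
    then show ?thesis
      by (simp add: log_def le_divide_eq mult_left_le)
  qed
  finally have "real (T - 1) \<le> F * log 2 (real (max 2 p))"
    using ratio_ge_1 by (simp add: field_simps)
  moreover have "1 * 1 \<le> F * log 2 (real (max 2 p))"
    using ratio_ge_1 by (intro mult_mono) (auto simp: one_le_log_cancel_iff)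
  ultimately show ?thesis
    using False by simp
qed

end

lemma cheapest:
  assumes "sts \<noteq> []"
  shows "cheapest sts \<in> set sts"
    and "t \<in> set sts \<Longrightarrow> length (snd (snd (cheapest sts))) \<le> length (snd (snd t))"
proof -
  let ?c = "\<lambda>s :: state. length (snd (snd s))"
  let ?f = "\<lambda>s t :: state. if \<not> drop (?c t) (snd (snd s)) = [] then t else s"
  have *: "foldl ?f s ts \<in> insert s (set ts) \<and> (\<forall>t \<in> insert s (set ts). ?c (foldl ?f s ts) \<le> ?c t)"
    for s ts
  proof (induction ts arbitrary: s)
    case (Cons u ts)
    have "foldl ?f s (u # ts) = foldl ?f (?f s u) ts" by simp
    with Cons[of "?f s u"] show ?case
      by (auto split: if_splits)
  qed simp
  obtain s ts where "sts = s # ts" using assms by (cases sts) auto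
  with *[of s ts] show "cheapest sts \<in> set sts"
    "t \<in> set sts \<Longrightarrow> ?c (cheapest sts) \<le> ?c t"
    by (auto simp: cheapest_def)
qed

lemma state_of_init:
  "(map (\<lambda>r. (r, False)) (map (char_vec [0..<n]) es), ones p, []) = state_of (n, es, p) k {} 0"
  by (simp add: state_of_def table_def)

lemma greedy_eq:
  "greedy a (ones n) (ones p) (map (char_vec [0..<n]) es) (ones k)
    = (greedy_round a (ones n) (ones k) ^^ length es) (state_of (n, es, p) k {} 0)"
  unfolding greedy_def state_of_init[of n es p k] foldl_const by simp

context dksh_solver
begin

text \<open>The cheapest finished run has some guess \<open>k\<close> and \<open>T\<close> charged
  rounds, the run with guess \<open>opt\<close> has \<open>T'\<close>. Then
  \<open>card (\<Union>P) \<le> k * T \<le> opt * T'\<close>, and only \<open>T'\<close> has to be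
  estimated.\<close>

lemma solve_correct:
  "\<exists>P. solve a (rows_of (n, es, p)) = char_vec es P \<and>
    mpu_approx (2 * F * log 2 (real (max 2 p))) E p P"
proof -
  let ?g = "\<lambda>ks. greedy a (ones n) (ones p) (map (char_vec [0..<n]) es) ks"
  let ?sts = "filter (\<lambda>st. fst (snd st) = []) (map ?g (guesses (ones n)))"
  let ?st = "cheapest ?sts"
  have len: "length es = card E" "p \<le> length es"
    using hyper by (auto simp: distinct_card)
  \<comment> \<open>As \<open>p \<le> length es\<close>, the linear bound of
    \<open>greedy_opt\<close> leaves nothing to pick.\<close>
  obtain P' T' where opt: "?g (ones opt) = state_of (n, es, p) opt P' T'" "p - card P' = 0"
    "T' = 0 \<or> 1 \<le> p * (1 - 1 / F) ^ (T' - 1)"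
    using greedy_opt[of "length es"] len(2) unfolding greedy_eq by force
  have opt_mem: "?g (ones opt) \<in> set ?sts"
    using opt(1,2) opt_le by (auto simp: set_guesses state_of_def image_iff)
  then have ne: "?sts \<noteq> []" by (metis empty_iff empty_set)
  note cheapest(1)[OF ne]
  then obtain k where k: "k \<le> n" "?st = ?g (ones k)" "fst (snd ?st) = []"
    by (auto simp: set_guesses)
  obtain P T where PT: "P \<subseteq> E" "card P \<le> p" "card (\<Union>P) \<le> k * T"
    "?st = state_of (n, es, p) k P T"
    using greedy_union[OF k(1), of "length es"] unfolding k(2) greedy_eq by blast
  have "card P = p"
    using PT(2,4) k(3) by (simp add: state_of_def)
  have "k * T \<le> opt * T'"
    using cheapest(2)[OF ne opt_mem] unfolding PT(4) opt(1) by (simp add: state_of_def)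
  with PT(3) have "real (card (\<Union>P)) \<le> real T' * real opt"
    by (metis le_trans mult.commute of_nat_le_iff of_nat_mult)
  also have "\<dots> \<le> 2 * F * log 2 (real (max 2 p)) * real opt"
    by (intro mult_right_mono rounds_bound opt(3)) simp
  finally have "mpu_approx (2 * F * log 2 (real (max 2 p))) E p P"
    using PT(1) \<open>card P = p\<close> by (simp add: mpu_approx_def)
  moreover have "solve a (rows_of (n, es, p)) = char_vec es P"
    unfolding solve_def using PT(4) by (simp add: state_of_def table_def char_vec_def)
  ultimately show ?thesis by blast
qed

end

section \<open>Running time\<close>

lemma ptime_row_subset [ptime_intros]:
  "ptime D f \<Longrightarrow> ptime D g \<Longrightarrow> ptime D (\<lambda>x. row_subset (f x) (g x))"
  unfolding row_subset_def by (intro ptime_intros)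

lemma ptime_free_rows [ptime_intros]:
  "ptime D f \<Longrightarrow> ptime D (\<lambda>x. free_rows (f x))"
  unfolding free_rows_def by (intro ptime_intros)

lemma ptime_query [ptime_intros]:
  "ptime D us \<Longrightarrow> ptime D ks \<Longrightarrow> ptime D f \<Longrightarrow> ptime D (\<lambda>x. query (us x) (ks x) (f x))"
  unfolding query_def by (intro ptime_intros)

text \<open>A mark takes one bit whatever its value, so the table keeps its length, and the counter
  only shrinks.\<close>

lemma len_pick:
  "len (fst (pick w tab cnt)) = len tab \<and> len (snd (pick w tab cnt)) \<le> len cnt"
proof -
  have "len (tl xs) \<le> len xs" for xs :: "bool list"
    by (cases xs) auto
  then show ?thesis
    by (induction tab) (auto simp: pick_def pick_row_def intro: order_trans)
qed

lemma ptime_pick_row [ptime_intros]: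
  assumes "ptime D w" "ptime D z" "ptime D s"
  shows "ptime D (\<lambda>x. pick_row (w x) (z x) (s x))"
  unfolding pick_row_def by (intro ptime_intros assms[THEN ptime_mono]) auto

lemma ptime_pick [ptime_intros]:
  assumes "ptime D w" "ptime D tab" "ptime D cnt"
  shows "ptime D (\<lambda>x. pick (w x) (tab x) (cnt x))"
  unfolding pick_def
proof (rule ptime_foldr[where B = "\<lambda>x. 2 * len (tab x) + 1 + len (cnt x)"])
  let ?S = "{(x, z, s). x \<in> D \<and>
    (\<exists>pre suf. tab x = pre @ z # suf \<and> s = foldr (pick_row (w x)) suf ([], cnt x))}"
  have "ptime ?S (\<lambda>u. w (fst u))"
    by (rule ptime_comp[OF assms(1)], intro ptime_intros) auto
  then show "ptime ?S (\<lambda>u. pick_row (w (fst u)) (fst (snd u)) (snd (snd u)))"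
    by (intro ptime_intros)
  fix x pre suf assume "tab x = pre @ suf"
  then show "len (foldr (pick_row (w x)) suf ([], cnt x)) \<le> 2 * len (tab x) + 1 + len (cnt x)"
    using len_pick[of "w x" suf "cnt x"] unfolding pick_def
    by (cases "foldr (pick_row (w x)) suf ([], cnt x)") (auto simp: len_append)
qed (intro assms ptime_intros polybound_intros polybound_len)+

text \<open>\<open>Q\<close> is where \<open>a\<close> is known to run in polynomial time. The query
  has to lie in it only for states in which something is still to be picked.\<close>

lemma ptime_greedy_round:
  assumes "ptime Q a" "ptime D us" "ptime D ks" "ptime D st"
    and "\<And>x. x \<in> D \<Longrightarrow> fst (snd (st x)) \<noteq> [] \<Longrightarrow> query (us x) (ks x) (fst (st x)) \<in> Q"
  shows "ptime D (\<lambda>x. greedy_round a (us x) (ks x) (st x))"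
proof -
  let ?D = "{x \<in> D. fst (snd (st x)) \<noteq> []}"
  note on_D = assms(2-4)[THEN ptime_mono, of ?D, OF Collect_restrict]
  have "ptime ?D (\<lambda>x. a (query (us x) (ks x) (fst (st x))))"
    by (rule ptime_comp[OF assms(1)], intro ptime_intros on_D) (use assms(5) in auto)
  then show ?thesis
    unfolding greedy_round_def step_state_def
    by (intro ptime_intros on_D assms(2-4) ptime_mono[OF assms(4) Collect_restrict])
qed

lemma len_ones: "len (ones k) = 3 * k"
  by (induction k) auto

lemma len_table: "len (table n es P) = len (map (\<lambda>r. (r, False)) (map (char_vec [0..<n]) es))"
  by (induction es) (auto simp: table_def)

text \<open>On reachable states the query encodes a residual hypergraph, to which the assumption on
  \<open>a\<close> applies. The table keeps its size, the counter does not grow, and at most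
  \<open>k\<close> is charged per row, so the fold has a polynomial size bound.\<close>

lemma ptime_greedy:
  assumes "ptime (encode ` dksh_instances) a"
  shows "ptime {(x, ks). \<exists>i \<in> mpu_instances. \<exists>k \<le> fst i. x = rows_of i \<and> ks = ones k}
    (\<lambda>(x, ks). greedy a (fst x) (fst (snd x)) (snd (snd x)) ks)"
proof -
  define D where "D = {(x, ks). \<exists>i \<in> mpu_instances. \<exists>k \<le> fst i. x = rows_of i \<and> ks = ones k}"
  let ?init = "\<lambda>z. (map (\<lambda>r. (r, False)) (snd (snd (fst z))), fst (snd (fst z)), []) :: state"
  let ?f = "\<lambda>z st _. greedy_round a (fst (fst z)) (snd z) st"
  \<comment> \<open>Summands for the table, the counter and the charge. The last is a product: the
    encodings of the rows and of \<open>k\<close> bound the number of rounds and the charge per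
    round.\<close>
  let ?B = "\<lambda>z :: (bool list \<times> bool list \<times> bool list list) \<times> bool list.
    2 * len (map (\<lambda>r. (r, False)) (snd (snd (fst z)))) + 1
      + (2 * len (fst (snd (fst z))) + 1 + len (snd (snd (fst z))) * len (snd z))"
  have reach: "\<exists>n es p k P T. (n, es, p) \<in> mpu_instances \<and> k \<le> n \<and> z = (rows_of (n, es, p), ones k) \<and>
      T \<le> length es \<and> foldl (?f z) (?init z) pre = state_of (n, es, p) k P T"
    if z: "z \<in> D" and pre: "snd (snd (fst z)) = pre @ suf" for z pre suf
  proof -
    obtain n es p k where nk: "(n, es, p) \<in> mpu_instances" "k \<le> n" "z = (rows_of (n, es, p), ones k)"
      using z by (auto simp: D_def)
    then have "length pre \<le> length es"
      using arg_cong[OF pre, of length] by simp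
    moreover have "foldl (?f z) (?init z) pre
        = (greedy_round a (ones n) (ones k) ^^ length pre) (state_of (n, es, p) k {} 0)"
      unfolding foldl_const nk(3) by (simp add: state_of_def table_def comp_def)
    ultimately show ?thesis
      using greedy_prefix[OF nk(1), of "length pre" a k] nk by (metis le_trans)
  qed
  have "ptime D (\<lambda>z. foldl (?f z) (?init z) (snd (snd (fst z))))"
  proof (rule ptime_foldl[where B = ?B])
    show "ptime D (\<lambda>z. snd (snd (fst z)))" "ptime D ?init"
      by (intro ptime_intros)+
    show "polybound D ?B"
      by (intro polybound_intros polybound_len ptime_intros)
    let ?S = "{(z, acc, y). z \<in> D \<and> (\<exists>pre suf. snd (snd (fst z)) = pre @ y # suf \<and>
      acc = foldl (?f z) (?init z) pre)}"
    show "ptime ?S (\<lambda>u. greedy_round a (fst (fst (fst u))) (snd (fst u)) (fst (snd u)))"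
    proof (rule ptime_greedy_round[OF assms])
      fix u assume "u \<in> ?S"
      then obtain z y pre suf where u: "u = (z, foldl (?f z) (?init z) pre, y)" "z \<in> D"
        "snd (snd (fst z)) = pre @ y # suf"
        by blast
      obtain n es p k P T where s: "(n, es, p) \<in> mpu_instances" "k \<le> n"
        "fst u = (rows_of (n, es, p), ones k)" "fst (snd u) = state_of (n, es, p) k P T"
        using reach[OF u(2,3)] unfolding u(1) by auto
      have "query (fst (fst (fst u))) (snd (fst u)) (fst (fst (snd u)))
          = encode (n, filter (\<lambda>e. e \<notin> P) es, k)"
        unfolding s(3,4) by (simp add: state_of_def query_table del: encode.simps)
      moreover have "(n, filter (\<lambda>e. e \<notin> P) es, k) \<in> dksh_instances"
        using s(1,2) by (auto simp: dksh_instances_def mpu_instances_def hypergraph_def)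
      ultimately show "query (fst (fst (fst u))) (snd (fst u)) (fst (fst (snd u)))
          \<in> encode ` dksh_instances"
        by (metis imageI)
    qed (intro ptime_intros)+
    fix z pre suf assume z: "z \<in> D" "snd (snd (fst z)) = pre @ suf"
    from reach[OF this] obtain n es p k P T where s: "T \<le> length es"
      "z = (rows_of (n, es, p), ones k)" "foldl (?f z) (?init z) pre = state_of (n, es, p) k P T"
      by blast
    have "T \<le> len (map (char_vec [0..<n]) es)"
      using length_le_len[of "map (char_vec [0..<n]) es"] s(1) by simp
    then have "len (ones (k * T)) \<le> len (snd (snd (fst z))) * len (snd z)"
      by (simp add: s(2) len_ones)
    moreover have "len (ones (p - card P)) \<le> len (fst (snd (fst z)))"
      by (simp add: s(2) len_ones)
    moreover have "len (table n es P) = len (map (\<lambda>r. (r, False)) (snd (snd (fst z))))"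
      by (simp only: s(2) rows_of.simps fst_conv snd_conv len_table)
    ultimately show "len (foldl (?f z) (?init z) pre) \<le> ?B z"
      unfolding s(3) state_of_def prod.case len_Pair by linarith
  qed
  then show ?thesis
    unfolding D_def greedy_def split_def .
qed

lemma ptime_guesses [ptime_intros]:
  assumes "ptime D us"
  shows "ptime D (\<lambda>x. guesses (us x))"
  unfolding guesses_def
\<comment> \<open>There are at most \<open>1 + len (us x)\<close> guesses, and an encoded unary
  number takes three bits per unit.\<close>
proof (rule ptime_foldl[where B = "\<lambda>x. (1 + len (us x)) * (2 * (3 * len (us x)) + 1)"])
  fix x pre suf assume x: "us x = pre @ suf"
  have "length pre \<le> len (us x)"
    using length_le_len[of "us x"] x by simp
  have "len (guesses pre) \<le> length (guesses pre) * (2 * (3 * length pre) + 1)"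
    by (rule len_list_le) (auto simp: set_guesses len_ones)
  also have "\<dots> \<le> (1 + len (us x)) * (2 * (3 * len (us x)) + 1)"
    using \<open>length pre \<le> len (us x)\<close> by (intro mult_mono) (auto simp: guesses_eq)
  finally show "len (foldl (\<lambda>acc _. [] # map (\<lambda>ks. True # ks) acc) [[]] pre)
      \<le> (1 + len (us x)) * (2 * (3 * len (us x)) + 1)"
    by (simp only: guesses_def)
qed (intro assms ptime_intros polybound_intros polybound_len)+

text \<open>The accumulator of the fold is always one of the candidates, hence no longer than their
  list.\<close>

lemma ptime_cheapest [ptime_intros]:
  assumes "ptime D f"
  shows "ptime D (\<lambda>x. cheapest (f x))"
  unfolding cheapest_def
proof (intro ptime_if ptime_null assms ptime_const
    ptime_foldl[where B = "\<lambda>x. len (f x)"])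
  let ?D = "{x \<in> D. f x \<noteq> []}"
  let ?f = "\<lambda>s t :: state. if drop (length (snd (snd t))) (snd (snd s)) \<noteq> [] then t else s"
  have f: "ptime ?D f"
    using assms by (rule ptime_mono) auto
  show "ptime ?D (\<lambda>x. hd (f x))" "ptime ?D (\<lambda>x. tl (f x))" "polybound ?D (\<lambda>x. len (f x))"
    by (intro ptime_hd ptime_tl polybound_len f; simp)+
  fix x pre suf assume x: "x \<in> ?D" "tl (f x) = pre @ suf"
  have "foldl ?f (hd (f x)) pre \<in> set (f x)"
    using cheapest(1)[of "hd (f x) # pre"] x by (cases "f x") (auto simp: cheapest_def)
  then show "len (foldl ?f (hd (f x)) pre) \<le> len (f x)"
    by (rule len_elem)
qed (intro ptime_intros)+

lemma ptime_solve:
  assumes "ptime (encode ` dksh_instances) a"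
  shows "ptime (rows_of ` mpu_instances) (solve a)"
proof -
  let ?g = "\<lambda>x ks. greedy a (fst x) (fst (snd x)) (snd (snd x)) ks"
  have "ptime (rows_of ` mpu_instances) (\<lambda>x. map (?g x) (guesses (fst x)))"
    by (intro ptime_map ptime_intros ptime_comp_eq[OF ptime_greedy[OF assms] ptime_id])
      (force simp: set_guesses)
  then have "ptime (rows_of ` mpu_instances)
      (\<lambda>x. filter (\<lambda>st. fst (snd st) = []) (map (?g x) (guesses (fst x))))"
    by (rule ptime_filter) (intro ptime_intros)
  then show ?thesis
    unfolding solve_def by (intro ptime_map[OF ptime_fst[OF ptime_cheapest]] ptime_snd ptime_id)
qed

section \<open>Reading the input in polynomial time\<close>

lemma ptime_after_unary [ptime_intros]: "ptime D f \<Longrightarrow> ptime D (\<lambda>x. after_unary (f x))"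
  unfolding after_unary_def by (intro ptime_intros)

text \<open>Each extracted row is a piece of \<open>w x\<close>, so the rows together take at most
  \<open>length (ms x)\<close> times a bound for the whole string.\<close>

lemma ptime_split_rows [ptime_intros]:
  assumes "ptime D us" "ptime D ms" "ptime D w"
  shows "ptime D (\<lambda>x. split_rows (us x) (ms x) (w x))"
  unfolding split_rows_def
proof (intro ptime_rev ptime_fst ptime_foldl[where
      B = "\<lambda>x. 2 * (len (ms x) * (2 * len (w x) + 1)) + 1 + len (w x)"])
  fix x pre suf assume x: "ms x = pre @ suf"
  let ?f = "\<lambda>s _. (take (length (us x)) (snd s) # fst s, drop (length (us x)) (snd s))"
  have take: "len (take m v) \<le> len v" for m and v :: "bool list"
    by (metis append_take_drop_id le_add1 len_append)
  have "len (fst (foldl ?f ([], w x) ys)) \<le> length ys * (2 * len (w x) + 1) \<and>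
      len (snd (foldl ?f ([], w x) ys)) \<le> len (w x)" for ys :: "bool list"
  proof (induction ys rule: rev_induct)
    case (snoc y ys)
    then show ?case
      using take[of "length (us x)" "snd (foldl ?f ([], w x) ys)"]
        len_drop[of "length (us x)" "snd (foldl ?f ([], w x) ys)"] by simp
  qed simp
  note this[of pre]
  moreover have "length pre * (2 * len (w x) + 1) \<le> len (ms x) * (2 * len (w x) + 1)"
    using length_le_len[of "ms x"] x by (intro mult_right_mono) auto
  ultimately show "len (foldl ?f ([], w x) pre)
      \<le> 2 * (len (ms x) * (2 * len (w x) + 1)) + 1 + len (w x)"
    by (cases "foldl ?f ([], w x) pre") auto
next
  let ?S = "{(x, acc, y). x \<in> D \<and> (\<exists>pre suf. ms x = pre @ y # suf \<and> acc = foldl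
    (\<lambda>s _. (take (length (us x)) (snd s) # fst s, drop (length (us x)) (snd s))) ([], w x) pre)}"
  have "ptime ?S (\<lambda>u. us (fst u))"
    by (rule ptime_comp[OF assms(1)], intro ptime_intros) auto
  then show "ptime ?S (\<lambda>u. (take (length (us (fst u))) (snd (fst (snd u))) # fst (fst (snd u)),
      drop (length (us (fst u))) (snd (fst (snd u)))))"
    by (intro ptime_intros)
qed (intro assms ptime_intros polybound_intros polybound_len)+

lemma ptime_parse: "ptime D parse"
  unfolding parse_def by (intro ptime_intros)

section \<open>From the given program to the new one\<close>

theorem theorem5:
  shows "\<exists>C :: real. C > 0 \<and>
    (\<forall>f :: nat set \<Rightarrow> nat set set \<Rightarrow> real.
       approx_ratio f \<longrightarrow>
       (\<exists>A. dksh_approx_algorithm f A) \<longrightarrow>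
       (\<exists>B. mpu_approx_algorithm (\<lambda>V E p. C * f V E * log 2 (real (max 2 p))) B))"
proof (intro exI[of _ 2] conjI allI impI)
  fix f :: "nat set \<Rightarrow> nat set set \<Rightarrow> real"
  assume ratio: "approx_ratio f" and "\<exists>A. dksh_approx_algorithm f A"
  then obtain A q where A: "\<And>x. x \<in> dksh_instances \<Longrightarrow> \<exists>t s.
      exec A (initial_store (encode x)) t s \<and> t \<le> poly q (length (encode x)) \<and>
      (case x of (n, es, k) \<Rightarrow> \<lambda>w. \<exists>W. w = char_vec [0..<n] W \<and>
        dksh_approx (f {..<n} (set es)) {..<n} (set es) k W) (s 0)"
    unfolding dksh_approx_algorithm_def solves_in_poly_time_def by blast
  \<comment> \<open>The program is replaced by the function it computes; its running time enters
    through \<open>ptime_result\<close>, its answers through \<open>solver\<close>.\<close>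
  define a where "a = result A"
  have "ptime (encode ` dksh_instances) a"
    unfolding a_def by (rule ptime_result[where q = q]) (use A in blast)
  \<comment> \<open>Parsing turns an encoded instance into its rows, where
    \<open>ptime_solve\<close> applies.\<close>
  then have "ptime (encode ` mpu_instances) (\<lambda>w. solve a (parse w))"
    by (rule ptime_comp[OF ptime_solve ptime_parse])
      (auto simp: parse_encode simp del: encode.simps rows_of.simps)
  then have "polyrun (encode ` mpu_instances) (\<lambda>w. w) (\<lambda>w. solve a (parse w))"
    by (rule ptime_polyrun)
  then obtain B r where B: "\<And>x. x \<in> mpu_instances \<Longrightarrow>
      runs B (initial_store (encode x)) (poly r (length (encode x)))
        (initial_store (solve a (rows_of x)))"
    unfolding polyrun_def by (auto simp: parse_encode simp del: encode.simps rows_of.simps)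
  have solver: "case x of (m, es', k) \<Rightarrow> \<exists>W. a (encode x) = char_vec [0..<m] W \<and>
      dksh_approx (f {..<m} (set es')) {..<m} (set es') k W" if "x \<in> dksh_instances" for x
    using A[OF that] result_eq[of A "encode x"] unfolding a_def by (auto split: prod.splits)
  have "mpu_approx_algorithm (\<lambda>V E p. 2 * f V E * log 2 (real (max 2 p))) B"
    unfolding mpu_approx_algorithm_def solves_in_poly_time_def
  proof (intro exI[of _ r] ballI)
    fix x assume x: "x \<in> mpu_instances"
    obtain n es p where nep: "x = (n, es, p)" by (cases x)
    interpret dksh_solver a f n es p
      by unfold_locales (use x nep ratio solver in auto)
    obtain t where "t \<le> poly r (length (encode x))"
      "exec B (initial_store (encode x)) t (initial_store (solve a (rows_of x)))"
      using B[OF x] unfolding runs_def by blast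
    moreover have "\<exists>E'. initial_store (solve a (rows_of x)) 0 = char_vec es E' \<and>
        mpu_approx (2 * f {..<n} (set es) * log 2 (real (max 2 p))) (set es) p E'"
      using solve_correct by (simp only: nep initial_store_0)
    ultimately show "\<exists>t s. exec B (initial_store (encode x)) t s \<and> t \<le> poly r (length (encode x)) \<and>
      (case x of (n, es, p) \<Rightarrow> \<lambda>w. \<exists>E'. w = char_vec es E' \<and>
        mpu_approx (2 * f {..<n} (set es) * log 2 (real (max 2 p))) (set es) p E') (s 0)"
      unfolding nep prod.case by blast
  qed
  then show "\<exists>B. mpu_approx_algorithm (\<lambda>V E p. 2 * f V E * log 2 (real (max 2 p))) B" ..
qed simp

end
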